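(* Let $(M,\phi,\xi,\eta,g)$ be an almost cosymplectic $(\kappa,\mu)$-space of dimension greater than or equal to $5$ with $\kappa<0$. Then its Riemann curvature tensor can be written as $$R=-\kappa R_3-R_{5,2}-\mu R_6 .$$ Therefore, $M$ is a generalized $(\kappa,\mu)$-space form with divided $R_5$, $M(f_1,\ldots,f_{5,1},f_{5,2},f_6)$, with functions $$f_1=f_2=0,\quad f_3=-\kappa,\quad f_4=f_{5,1}=0,\quad f_{5,2}=-1,\quad f_6=-\mu .$$
   Context: Manifolds, tensor fields and functions are smooth. An almost contact metric manifold $(M,\phi,\xi,\eta,g)$ is an odd-dimensional Riemannian manifold $(M,g)$ with a $(1,1)$-tensor field $\phi$, a vector field $\xi$ and a 1-form $\eta$ such that $\eta(\xi)=1$, $\phi^2X=-X+\eta(X)\xi$ and $g(\phi X,\phi Y)=g(X,Y)-\eta(X)\eta(Y)$. Its fundamental 2-form is $\Phi(X,Y)=g(X,\phi Y)$. It is almost cosymplectic if $d\eta=0$ and $d\Phi=0$. Put $h=\frac12L_\xi\phi$ ($L$ the Lie derivative) and $R(X,Y)Z=\nabla_X\nabla_YZ-\nabla_Y\nabla_XZ-\nabla_{[X,Y]}Z$, with $\nabla$ the Levi-Civita connection. A $(\kappa,\mu)$-space is an almost contact metric manifold satisfying, for some functions $\kappa,\mu$ on $M$ and all $X,Y$, $R(X,Y)\xi=\kappa\{\eta(Y)X-\eta(X)Y\}+\mu\{\eta(Y)hX-\eta(X)hY\}$. A generalized $(\kappa,\mu)$-space form with divided $R_5$, denoted $M(f_1,\ldots,f_{5,1},f_{5,2},f_6)$,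 is an almost contact metric manifold whose curvature tensor can be written as $R=f_1R_1+f_2R_2+f_3R_3+f_4R_4+f_{5,1}R_{5,1}+f_{5,2}R_{5,2}+f_6R_6$ with $f_i$ functions on $M$, where for all vector fields $X,Y,Z$: $R_1(X,Y)Z=g(Y,Z)X-g(X,Z)Y$; $R_2(X,Y)Z=g(X,\phi Z)\phi Y-g(Y,\phi Z)\phi X+2g(X,\phi Y)\phi Z$; $R_3(X,Y)Z=\eta(X)\eta(Z)Y-\eta(Y)\eta(Z)X+g(X,Z)\eta(Y)\xi-g(Y,Z)\eta(X)\xi$; $R_4(X,Y)Z=g(Y,Z)hX-g(X,Z)hY+g(hY,Z)X-g(hX,Z)Y$; $R_{5,1}(X,Y)Z=g(hY,Z)hX-g(hX,Z)hY$; $R_{5,2}(X,Y)Z=g(\phi hY,Z)\phi hX-g(\phi hX,Z)\phi hY$; $R_6(X,Y)Z=\eta(X)\eta(Z)hY-\eta(Y)\eta(Z)hX+g(hX,Z)\eta(Y)\xi-g(hY,Z)\eta(X)\xi$. *)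

theory Defs
  imports "HOL-Analysis.Analysis" "HOL-Library.Function_Algebras"
begin

section \<open>Smooth manifolds\<close>

text \<open>
  \<^term>\<open>Ck_on k S f\<close> is meant for open \<^term>\<open>S\<close> only: then all iterated directional derivatives of
  order at most \<^term>\<open>k\<close> exist and are continuous on \<^term>\<open>S\<close>.
\<close>

primrec Ck_on ::
  "nat \<Rightarrow> 'e::euclidean_space set \<Rightarrow> ('e \<Rightarrow> 'b::real_normed_vector) \<Rightarrow> bool" where
  "Ck_on 0 S f \<longleftrightarrow> continuous_on S f"
| "Ck_on (Suc k) S f \<longleftrightarrow>
     f differentiable_on S \<and> (\<forall>v. Ck_on k S (\<lambda>x. frechet_derivative f (at x) v))"

definition smooth_on :: "'e::euclidean_space set \<Rightarrow> ('e \<Rightarrow> 'b::real_normed_vector) \<Rightarrow> bool" where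
  "smooth_on S f \<longleftrightarrow> (\<forall>k. Ck_on k S f)"

text \<open>
  The manifold is the whole type \<^typ>\<open>'a\<close>; a chart is a pair of its domain and the coordinate map
  into \<^typ>\<open>'e\<close>, so the dimension is \<open>DIM('e)\<close>. The Hausdorff and second countability axioms are
  the sorts \<^class>\<open>t2_space\<close> and \<^class>\<open>second_countable_topology\<close>. The atlas need not be maximal: it
  and the maximal atlas containing it have the same smooth functions.
\<close>

definition smooth_atlas ::
  "('a::{t2_space,second_countable_topology} set \<times> ('a \<Rightarrow> 'e::euclidean_space)) set \<Rightarrow> bool" where
  "smooth_atlas A \<longleftrightarrow>
     (\<forall>(U, \<psi>) \<in> A. open U \<and> open (\<psi> ` U) \<and> homeomorphism U (\<psi> ` U) \<psi> (inv_into U \<psi>)) \<and>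
     (\<Union>(U, \<psi>) \<in> A. U) = UNIV \<and>
     (\<forall>(U, \<psi>) \<in> A. \<forall>(V, \<theta>) \<in> A. smooth_on (\<psi> ` (U \<inter> V)) (\<theta> \<circ> inv_into U \<psi>))"

type_synonym ('a, 'e) atlas = "('a set \<times> ('a \<Rightarrow> 'e)) set"

definition smooth_fun ::
  "('a::{t2_space,second_countable_topology}, 'e::euclidean_space) atlas \<Rightarrow> ('a \<Rightarrow> real) \<Rightarrow> bool" where
  "smooth_fun A f \<longleftrightarrow> (\<forall>(U, \<psi>) \<in> A. smooth_on (\<psi> ` U) (f \<circ> inv_into U \<psi>))"


section \<open>Tangent vectors, vector fields and tensor fields\<close>

text \<open>
  Tangent vectors at a point are derivations of the algebra of smooth functions. They are extended
  by the value 0 to non-smooth functions, which makes equality of tangent vectors plain equality.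
  Sums and differences of functions, tangent vectors and vector fields are the pointwise operations
  of \<^theory>\<open>HOL-Library.Function_Algebras\<close>.
\<close>

type_synonym 'a tvec = "('a \<Rightarrow> real) \<Rightarrow> real"
type_synonym 'a vfield = "'a \<Rightarrow> 'a tvec"

definition tangent_space ::
  "('a::{t2_space,second_countable_topology}, 'e::euclidean_space) atlas \<Rightarrow> 'a \<Rightarrow> 'a tvec set" where
  "tangent_space A p = {v.
     (\<forall>f g. smooth_fun A f \<longrightarrow> smooth_fun A g \<longrightarrow> v (f + g) = v f + v g) \<and>
     (\<forall>c f. smooth_fun A f \<longrightarrow> v (\<lambda>q. c * f q) = c * v f) \<and>
     (\<forall>f g. smooth_fun A f \<longrightarrow> smooth_fun A g \<longrightarrow> v (f * g) = v f * g p + f p * v g) \<and>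
     (\<forall>f. \<not> smooth_fun A f \<longrightarrow> v f = 0)}"

definition linear_on_space :: "'a tvec set \<Rightarrow> ('a tvec \<Rightarrow> 'a tvec) \<Rightarrow> bool" where
  "linear_on_space T F \<longleftrightarrow>
     (\<forall>v\<in>T. \<forall>w\<in>T. F (v + w) = F v + F w) \<and>
     (\<forall>c. \<forall>v\<in>T. F (\<lambda>f. c * v f) = (\<lambda>f. c * F v f))"

definition linear_form_on :: "'a tvec set \<Rightarrow> ('a tvec \<Rightarrow> real) \<Rightarrow> bool" where
  "linear_form_on T \<omega> \<longleftrightarrow>
     (\<forall>v\<in>T. \<forall>w\<in>T. \<omega> (v + w) = \<omega> v + \<omega> w) \<and>
     (\<forall>c. \<forall>v\<in>T. \<omega> (\<lambda>f. c * v f) = c * \<omega> v)"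

definition vderiv :: "'a vfield \<Rightarrow> ('a \<Rightarrow> real) \<Rightarrow> ('a \<Rightarrow> real)" where
  "vderiv X f = (\<lambda>p. X p f)"

definition vector_field ::
  "('a::{t2_space,second_countable_topology}, 'e::euclidean_space) atlas \<Rightarrow> 'a vfield \<Rightarrow> bool" where
  "vector_field A X \<longleftrightarrow>
     (\<forall>p. X p \<in> tangent_space A p) \<and> (\<forall>f. smooth_fun A f \<longrightarrow> smooth_fun A (vderiv X f))"

definition fscale :: "('a \<Rightarrow> real) \<Rightarrow> 'a vfield \<Rightarrow> 'a vfield" (infixr "*\<^sub>f" 75) where
  "f *\<^sub>f X = (\<lambda>p u. f p * X p u)"

definition lie_bracket ::
  "('a::{t2_space,second_countable_topology}, 'e::euclidean_space) atlas \<Rightarrow>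
     'a vfield \<Rightarrow> 'a vfield \<Rightarrow> 'a vfield" where
  "lie_bracket A X Y =
     (\<lambda>p f. if smooth_fun A f then X p (vderiv Y f) - Y p (vderiv X f) else 0)"

text \<open>
  Tensor fields are given by their values on the tangent spaces; a field of (multi)linear maps is
  smooth iff it takes smooth vector fields to smooth vector fields or functions.
\<close>

type_synonym 'a endo = "'a \<Rightarrow> 'a tvec \<Rightarrow> 'a tvec"
type_synonym 'a oneform = "'a \<Rightarrow> 'a tvec \<Rightarrow> real"
type_synonym 'a bilin = "'a \<Rightarrow> 'a tvec \<Rightarrow> 'a tvec \<Rightarrow> real"

definition ap1 :: "('a \<Rightarrow> 'a tvec \<Rightarrow> 'b) \<Rightarrow> 'a vfield \<Rightarrow> ('a \<Rightarrow> 'b)" where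
  "ap1 \<omega> X = (\<lambda>p. \<omega> p (X p))"

definition ap2 :: "'a bilin \<Rightarrow> 'a vfield \<Rightarrow> 'a vfield \<Rightarrow> ('a \<Rightarrow> real)" where
  "ap2 g X Y = (\<lambda>p. g p (X p) (Y p))"

definition endomorphism_field ::
  "('a::{t2_space,second_countable_topology}, 'e::euclidean_space) atlas \<Rightarrow> 'a endo \<Rightarrow> bool" where
  "endomorphism_field A \<phi> \<longleftrightarrow>
     (\<forall>p. linear_on_space (tangent_space A p) (\<phi> p) \<and>
          \<phi> p ` tangent_space A p \<subseteq> tangent_space A p) \<and>
     (\<forall>X. vector_field A X \<longrightarrow> vector_field A (ap1 \<phi> X))"

definition one_form ::
  "('a::{t2_space,second_countable_topology}, 'e::euclidean_space) atlas \<Rightarrow> 'a oneform \<Rightarrow> bool" where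
  "one_form A \<omega> \<longleftrightarrow>
     (\<forall>p. linear_form_on (tangent_space A p) (\<omega> p)) \<and>
     (\<forall>X. vector_field A X \<longrightarrow> smooth_fun A (ap1 \<omega> X))"

definition riemannian_metric ::
  "('a::{t2_space,second_countable_topology}, 'e::euclidean_space) atlas \<Rightarrow> 'a bilin \<Rightarrow> bool" where
  "riemannian_metric A g \<longleftrightarrow>
     (\<forall>p. \<forall>v\<in>tangent_space A p.
        linear_form_on (tangent_space A p) (g p v) \<and>
        (\<forall>w\<in>tangent_space A p. g p v w = g p w v) \<and>
        (v \<noteq> 0 \<longrightarrow> 0 < g p v v)) \<and>
     (\<forall>X Y. vector_field A X \<longrightarrow> vector_field A Y \<longrightarrow> smooth_fun A (ap2 g X Y))"

text \<open>Exterior derivatives by the invariant formula, without a normalising factor.\<close>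

definition ext_deriv1 ::
  "('a::{t2_space,second_countable_topology}, 'e::euclidean_space) atlas \<Rightarrow>
     ('a vfield \<Rightarrow> ('a \<Rightarrow> real)) \<Rightarrow> 'a vfield \<Rightarrow> 'a vfield \<Rightarrow> ('a \<Rightarrow> real)" where
  "ext_deriv1 A \<omega> X Y = vderiv X (\<omega> Y) - vderiv Y (\<omega> X) - \<omega> (lie_bracket A X Y)"

definition ext_deriv2 ::
  "('a::{t2_space,second_countable_topology}, 'e::euclidean_space) atlas \<Rightarrow>
     ('a vfield \<Rightarrow> 'a vfield \<Rightarrow> ('a \<Rightarrow> real)) \<Rightarrow>
     'a vfield \<Rightarrow> 'a vfield \<Rightarrow> 'a vfield \<Rightarrow> ('a \<Rightarrow> real)" where
  "ext_deriv2 A \<omega> X Y Z =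
     vderiv X (\<omega> Y Z) - vderiv Y (\<omega> X Z) + vderiv Z (\<omega> X Y)
     - \<omega> (lie_bracket A X Y) Z + \<omega> (lie_bracket A X Z) Y - \<omega> (lie_bracket A Y Z) X"

text \<open>The Lie derivative of a field of endomorphisms, as a map on vector fields.\<close>

definition lie_deriv_endo ::
  "('a::{t2_space,second_countable_topology}, 'e::euclidean_space) atlas \<Rightarrow>
     'a vfield \<Rightarrow> 'a endo \<Rightarrow> 'a vfield \<Rightarrow> 'a vfield" where
  "lie_deriv_endo A V \<phi> X = lie_bracket A V (ap1 \<phi> X) - ap1 \<phi> (lie_bracket A V X)"


section \<open>Levi-Civita connection and curvature\<close>

type_synonym 'a connection = "'a vfield \<Rightarrow> 'a vfield \<Rightarrow> 'a vfield"

definition affine_connection ::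
  "('a::{t2_space,second_countable_topology}, 'e::euclidean_space) atlas \<Rightarrow> 'a connection \<Rightarrow> bool" where
  "affine_connection A nabla \<longleftrightarrow>
     (\<forall>X Y. vector_field A X \<longrightarrow> vector_field A Y \<longrightarrow> vector_field A (nabla X Y)) \<and>
     (\<forall>X Y Z. vector_field A X \<longrightarrow> vector_field A Y \<longrightarrow> vector_field A Z \<longrightarrow>
        nabla (X + Y) Z = nabla X Z + nabla Y Z \<and>
        nabla X (Y + Z) = nabla X Y + nabla X Z) \<and>
     (\<forall>f X Y. smooth_fun A f \<longrightarrow> vector_field A X \<longrightarrow> vector_field A Y \<longrightarrow>
        nabla (f *\<^sub>f X) Y = f *\<^sub>f nabla X Y \<and>
        nabla X (f *\<^sub>f Y) = vderiv X f *\<^sub>f Y + f *\<^sub>f nabla X Y)"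

text \<open>
  The Levi-Civita connection is characterised as the torsion-free metric connection, which exists
  and is unique by the fundamental theorem of Riemannian geometry.
\<close>

definition levi_civita ::
  "('a::{t2_space,second_countable_topology}, 'e::euclidean_space) atlas \<Rightarrow>
     'a bilin \<Rightarrow> 'a connection \<Rightarrow> bool" where
  "levi_civita A g nabla \<longleftrightarrow>
     affine_connection A nabla \<and>
     (\<forall>X Y. vector_field A X \<longrightarrow> vector_field A Y \<longrightarrow>
        nabla X Y - nabla Y X = lie_bracket A X Y) \<and>
     (\<forall>X Y Z. vector_field A X \<longrightarrow> vector_field A Y \<longrightarrow> vector_field A Z \<longrightarrow>
        vderiv X (ap2 g Y Z) = ap2 g (nabla X Y) Z + ap2 g Y (nabla X Z))"

definition curvature ::
  "('a::{t2_space,second_countable_topology}, 'e::euclidean_space) atlas \<Rightarrow>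
     'a connection \<Rightarrow> 'a vfield \<Rightarrow> 'a vfield \<Rightarrow> 'a vfield \<Rightarrow> 'a vfield" where
  "curvature A nabla X Y Z =
     nabla X (nabla Y Z) - nabla Y (nabla X Z) - nabla (lie_bracket A X Y) Z"


section \<open>Almost contact metric structures\<close>

definition almost_contact_metric ::
  "('a::{t2_space,second_countable_topology}, 'e::euclidean_space) atlas \<Rightarrow>
     'a endo \<Rightarrow> 'a vfield \<Rightarrow> 'a oneform \<Rightarrow> 'a bilin \<Rightarrow> bool" where
  "almost_contact_metric A \<phi> \<xi> \<eta> g \<longleftrightarrow>
     smooth_atlas A \<and> odd DIM('e) \<and> riemannian_metric A g \<and>
     endomorphism_field A \<phi> \<and> vector_field A \<xi> \<and> one_form A \<eta> \<and>
     ap1 \<eta> \<xi> = 1 \<and>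
     (\<forall>X. vector_field A X \<longrightarrow> ap1 \<phi> (ap1 \<phi> X) = - X + ap1 \<eta> X *\<^sub>f \<xi>) \<and>
     (\<forall>X Y. vector_field A X \<longrightarrow> vector_field A Y \<longrightarrow>
        ap2 g (ap1 \<phi> X) (ap1 \<phi> Y) = ap2 g X Y - ap1 \<eta> X * ap1 \<eta> Y)"

definition fundamental_form ::
  "'a endo \<Rightarrow> 'a bilin \<Rightarrow> 'a vfield \<Rightarrow> 'a vfield \<Rightarrow> ('a \<Rightarrow> real)" where
  "fundamental_form \<phi> g X Y = ap2 g X (ap1 \<phi> Y)"

definition almost_cosymplectic ::
  "('a::{t2_space,second_countable_topology}, 'e::euclidean_space) atlas \<Rightarrow>
     'a endo \<Rightarrow> 'a vfield \<Rightarrow> 'a oneform \<Rightarrow> 'a bilin \<Rightarrow> bool" where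
  "almost_cosymplectic A \<phi> \<xi> \<eta> g \<longleftrightarrow>
     almost_contact_metric A \<phi> \<xi> \<eta> g \<and>
     (\<forall>X Y. vector_field A X \<longrightarrow> vector_field A Y \<longrightarrow> ext_deriv1 A (ap1 \<eta>) X Y = 0) \<and>
     (\<forall>X Y Z. vector_field A X \<longrightarrow> vector_field A Y \<longrightarrow> vector_field A Z \<longrightarrow>
        ext_deriv2 A (fundamental_form \<phi> g) X Y Z = 0)"

definition h_tensor ::
  "('a::{t2_space,second_countable_topology}, 'e::euclidean_space) atlas \<Rightarrow>
     'a endo \<Rightarrow> 'a vfield \<Rightarrow> 'a vfield \<Rightarrow> 'a vfield" where
  "h_tensor A \<phi> \<xi> X = (\<lambda>_. 1 / 2) *\<^sub>f lie_deriv_endo A \<xi> \<phi> X"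

definition kappa_mu_space ::
  "('a::{t2_space,second_countable_topology}, 'e::euclidean_space) atlas \<Rightarrow>
     'a endo \<Rightarrow> 'a vfield \<Rightarrow> 'a oneform \<Rightarrow> 'a bilin \<Rightarrow> 'a connection \<Rightarrow>
     ('a \<Rightarrow> real) \<Rightarrow> ('a \<Rightarrow> real) \<Rightarrow> bool" where
  "kappa_mu_space A \<phi> \<xi> \<eta> g nabla \<kappa> \<mu> \<longleftrightarrow>
     almost_contact_metric A \<phi> \<xi> \<eta> g \<and> levi_civita A g nabla \<and>
     smooth_fun A \<kappa> \<and> smooth_fun A \<mu> \<and>
     (\<forall>X Y. vector_field A X \<longrightarrow> vector_field A Y \<longrightarrow>
        curvature A nabla X Y \<xi> =
          \<kappa> *\<^sub>f (ap1 \<eta> Y *\<^sub>f X - ap1 \<eta> X *\<^sub>f Y)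
          + \<mu> *\<^sub>f (ap1 \<eta> Y *\<^sub>f h_tensor A \<phi> \<xi> X - ap1 \<eta> X *\<^sub>f h_tensor A \<phi> \<xi> Y))"


section \<open>Generalized \<open>(\<kappa>,\<mu>)\<close>-space forms with divided \<open>R\<^sub>5\<close>\<close>

text \<open>
  Here \<open>G\<close>, \<open>F\<close>, \<open>E\<close>, \<open>H\<close> are the actions of \<open>g\<close>, \<open>\<phi>\<close>, \<open>\<eta>\<close>, \<open>h\<close> on vector fields.
\<close>

context
  fixes G :: "'a vfield \<Rightarrow> 'a vfield \<Rightarrow> ('a \<Rightarrow> real)"
    and F :: "'a vfield \<Rightarrow> 'a vfield"
    and \<xi> :: "'a vfield"
    and E :: "'a vfield \<Rightarrow> ('a \<Rightarrow> real)"
    and H :: "'a vfield \<Rightarrow> 'a vfield"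
begin

definition R1 :: "'a vfield \<Rightarrow> 'a vfield \<Rightarrow> 'a vfield \<Rightarrow> 'a vfield" where
  "R1 X Y Z = G Y Z *\<^sub>f X - G X Z *\<^sub>f Y"

definition R2 :: "'a vfield \<Rightarrow> 'a vfield \<Rightarrow> 'a vfield \<Rightarrow> 'a vfield" where
  "R2 X Y Z = G X (F Z) *\<^sub>f F Y - G Y (F Z) *\<^sub>f F X + (2 * G X (F Y)) *\<^sub>f F Z"

definition R3 :: "'a vfield \<Rightarrow> 'a vfield \<Rightarrow> 'a vfield \<Rightarrow> 'a vfield" where
  "R3 X Y Z = (E X * E Z) *\<^sub>f Y - (E Y * E Z) *\<^sub>f X
     + (G X Z * E Y) *\<^sub>f \<xi> - (G Y Z * E X) *\<^sub>f \<xi>"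

definition R4 :: "'a vfield \<Rightarrow> 'a vfield \<Rightarrow> 'a vfield \<Rightarrow> 'a vfield" where
  "R4 X Y Z = G Y Z *\<^sub>f H X - G X Z *\<^sub>f H Y + G (H Y) Z *\<^sub>f X - G (H X) Z *\<^sub>f Y"

definition R5_1 :: "'a vfield \<Rightarrow> 'a vfield \<Rightarrow> 'a vfield \<Rightarrow> 'a vfield" where
  "R5_1 X Y Z = G (H Y) Z *\<^sub>f H X - G (H X) Z *\<^sub>f H Y"

definition R5_2 :: "'a vfield \<Rightarrow> 'a vfield \<Rightarrow> 'a vfield \<Rightarrow> 'a vfield" where
  "R5_2 X Y Z = G (F (H Y)) Z *\<^sub>f F (H X) - G (F (H X)) Z *\<^sub>f F (H Y)"

definition R6 :: "'a vfield \<Rightarrow> 'a vfield \<Rightarrow> 'a vfield \<Rightarrow> 'a vfield" where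
  "R6 X Y Z = (E X * E Z) *\<^sub>f H Y - (E Y * E Z) *\<^sub>f H X
     + (G (H X) Z * E Y) *\<^sub>f \<xi> - (G (H Y) Z * E X) *\<^sub>f \<xi>"

end

definition gen_space_form_divided_R5 ::
  "('a::{t2_space,second_countable_topology}, 'e::euclidean_space) atlas \<Rightarrow>
     'a endo \<Rightarrow> 'a vfield \<Rightarrow> 'a oneform \<Rightarrow> 'a bilin \<Rightarrow> 'a connection \<Rightarrow>
     ('a \<Rightarrow> real) \<Rightarrow> ('a \<Rightarrow> real) \<Rightarrow> ('a \<Rightarrow> real) \<Rightarrow> ('a \<Rightarrow> real) \<Rightarrow>
     ('a \<Rightarrow> real) \<Rightarrow> ('a \<Rightarrow> real) \<Rightarrow> ('a \<Rightarrow> real) \<Rightarrow> bool" where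
  "gen_space_form_divided_R5 A \<phi> \<xi> \<eta> g nabla f1 f2 f3 f4 f5_1 f5_2 f6 \<longleftrightarrow>
     almost_contact_metric A \<phi> \<xi> \<eta> g \<and> levi_civita A g nabla \<and>
     smooth_fun A f1 \<and> smooth_fun A f2 \<and> smooth_fun A f3 \<and> smooth_fun A f4 \<and>
     smooth_fun A f5_1 \<and> smooth_fun A f5_2 \<and> smooth_fun A f6 \<and>
     (\<forall>X Y Z. vector_field A X \<longrightarrow> vector_field A Y \<longrightarrow> vector_field A Z \<longrightarrow>
        curvature A nabla X Y Z =
          f1 *\<^sub>f R1 (ap2 g) X Y Z
          + f2 *\<^sub>f R2 (ap2 g) (ap1 \<phi>) X Y Z
          + f3 *\<^sub>f R3 (ap2 g) \<xi> (ap1 \<eta>) X Y Z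
          + f4 *\<^sub>f R4 (ap2 g) (h_tensor A \<phi> \<xi>) X Y Z
          + f5_1 *\<^sub>f R5_1 (ap2 g) (h_tensor A \<phi> \<xi>) X Y Z
          + f5_2 *\<^sub>f R5_2 (ap2 g) (ap1 \<phi>) (h_tensor A \<phi> \<xi>) X Y Z
          + f6 *\<^sub>f R6 (ap2 g) \<xi> (ap1 \<eta>) (h_tensor A \<phi> \<xi>) X Y Z)"

end

theory Submission
  imports Defs
begin

text \<open>
Write \<open>B X = \<nabla>\<^sub>X \<xi>\<close>. From \<open>d\<eta> = 0\<close> the operator \<open>B\<close> is self-adjoint, and \<open>d\<Phi> = 0\<close> forces it to
anticommute with \<open>\<phi>\<close>, forces \<open>\<nabla>\<^sub>\<xi> \<phi> = 0\<close>, and so gives \<open>h = \<phi> B\<close>, that is \<open>\<phi> h = - B\<close>. The distribution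
\<open>ker \<eta>\<close> is integrable, and up to sign \<open>B\<close> is the shape operator of its leaves. Evaluating the
\<open>(\<kappa>,\<mu>)\<close>-condition on \<open>(X, \<xi>)\<close> and comparing with its conjugate by \<open>\<phi>\<close> yields \<open>B\<^sup>2 = - \<kappa>\<close> on \<open>ker \<eta>\<close>
(\<open>BB\<close>); evaluating it on horizontal pairs yields the Codazzi equation for \<open>B\<close> (\<open>C_swap_left\<close>).

The heart of the proof is that the leaves are flat (\<open>leaf_flat\<close>). The eigenspaces of \<open>B\<close> for
\<open>\<plusminus> sqrt (- \<kappa>)\<close> are interchanged by \<open>\<phi>\<close>, so in dimension at least 5 they have dimension at least 2. A
Codazzi tensor has an eigenvalue of multiplicity at least 2 only if that eigenvalue is constant along
its eigenspace, hence \<open>\<kappa>\<close> is constant along the leaves (\<open>kappa_constant_hor\<close>). A Codazzi tensor with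
two constant eigenvalues is parallel (\<open>C_zero\<close>), and an almost Kaehler structure that anticommutes with such a
parallel \<open>B\<close> is Kaehler (\<open>T_zero\<close>). The leaf curvature therefore commutes with both \<open>B\<close> and \<open>\<phi>\<close>: it
splits along the two eigenspaces of \<open>B\<close>, and as \<open>\<phi>\<close> interchanges them it is zero.

The Gauss equation then gives the curvature on horizontal fields as minus the quadratic term in
\<open>B = - \<phi> h\<close>, which is \<open>- R\<^sub>5\<^sub>,\<^sub>2\<close>; all components involving \<open>\<xi>\<close> follow from the \<open>(\<kappa>,\<mu>)\<close>-condition and
the symmetries of the curvature tensor and give \<open>- \<kappa> R\<^sub>3 - \<mu> R\<^sub>6\<close> (\<open>K_formula\<close>).

Eigenvectors of \<open>B\<close> appear only at a single point, for the constancy of \<open>\<kappa>\<close>. Every other algebraic argument is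
an identity between scalar functions of global vector fields with powers of \<open>B\<close> inserted, which avoids
having to differentiate \<open>sqrt (- \<kappa>)\<close>. The dimension enters only through the existence of a vector field that is
nonzero at a given point and annihilated there by three prescribed linear forms
(\<open>exists_vector_field_annihilated\<close>); it is built in a chart with a smooth bump function, and this is the reason
for the calculus of smooth functions in the first part.
\<close>

section \<open>Calculus of smooth functions on open sets\<close>

lemma Ck_on_has_derivative:
  assumes "open S" "Ck_on (Suc k) S f" "x \<in> S"
  shows "(f has_derivative frechet_derivative f (at x)) (at x)"
proof -
  have "f differentiable (at x)"
    using assms at_within_open[of x S] by (auto simp: differentiable_on_def)
  then show ?thesis using frechet_derivative_works by blast
qed

lemma Ck_on_cong:
  assumes "open S" "\<And>x. x \<in> S \<Longrightarrow> f x = w x" "Ck_on k S f"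
  shows "Ck_on k S w"
  using assms(2,3)
proof (induction k arbitrary: f w)
  case 0
  have "continuous_on S f \<longleftrightarrow> continuous_on S w"
    by (rule continuous_on_cong) (use 0(1) in auto)
  then show ?case using 0(2) by simp
next
  case (Suc k)
  have d: "(w has_derivative frechet_derivative f (at x)) (at x)" if "x \<in> S" for x
    by (rule has_derivative_transform_within_open[OF Ck_on_has_derivative[OF assms(1) Suc.prems(2) that] assms(1) that])
      (rule Suc.prems(1))
  have "Ck_on k S (\<lambda>x. frechet_derivative w (at x) v)" for v
  proof (rule Suc.IH[of "\<lambda>x. frechet_derivative f (at x) v"])
    show "frechet_derivative f (at x) v = frechet_derivative w (at x) v" if "x \<in> S" for x
      using frechet_derivative_at[OF d[OF that]] by simp
    show "Ck_on k S (\<lambda>x. frechet_derivative f (at x) v)"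
      using Suc.prems(2) by simp
  qed
  moreover have "w differentiable_on S"
    unfolding differentiable_on_def differentiable_def
    using d has_derivative_at_withinI by metis
  ultimately show ?case by simp
qed

text \<open>
The derivative is given explicitly as \<open>f'\<close>, so that the inductions on \<open>k\<close> below can take it from the
differentiation rules for \<^const>\<open>has_derivative\<close>.
\<close>

lemma Ck_on_SucI:
  assumes S: "open S"
    and d: "\<And>x. x \<in> S \<Longrightarrow> (f has_derivative f' x) (at x)"
    and k: "\<And>v. Ck_on k S (\<lambda>x. f' x v)"
  shows "Ck_on (Suc k) S f"
proof -
  have "Ck_on k S (\<lambda>x. frechet_derivative f (at x) v)" for v
  proof (rule Ck_on_cong[OF S _ k[of v]])
    show "f' x v = frechet_derivative f (at x) v" if "x \<in> S" for x
      using frechet_derivative_at[OF d[OF that]] by simp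
  qed
  moreover have "f differentiable_on S"
    unfolding differentiable_on_def differentiable_def
    using d has_derivative_at_withinI by metis
  ultimately show ?thesis by simp
qed

lemma Ck_on_local:
  assumes "open S" "\<And>x. x \<in> S \<Longrightarrow> \<exists>T. open T \<and> x \<in> T \<and> Ck_on k T f"
  shows "Ck_on k S f"
  using assms(2)
proof (induction k arbitrary: f)
  case 0
  have "isCont f x" if "x \<in> S" for x
    using 0[OF that] by (auto simp: continuous_on_eq_continuous_at)
  then show ?case using assms(1) by (simp add: continuous_on_eq_continuous_at)
next
  case (Suc k)
  have "(f has_derivative frechet_derivative f (at x)) (at x)" if "x \<in> S" for x
    using Suc.prems[OF that] Ck_on_has_derivative by blast
  moreover have "Ck_on k S (\<lambda>x. frechet_derivative f (at x) v)" for v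
    by (rule Suc.IH) (use Suc.prems in fastforce)
  ultimately show ?case
    by (rule Ck_on_SucI[OF assms(1)])
qed

lemma Ck_on_subset:
  assumes "open S" "open T" "S \<subseteq> T" "Ck_on k T f"
  shows "Ck_on k S f"
  using Ck_on_local[OF assms(1)] assms by blast

lemma Ck_on_SucD:
  assumes "open S" "Ck_on (Suc k) S f"
  shows "Ck_on k S f"
  using assms(2)
proof (induction k arbitrary: f)
  case 0
  then show ?case by (auto simp: differentiable_imp_continuous_on)
next
  case (Suc k)
  then show ?case by auto
qed

lemma Ck_on_const: "open S \<Longrightarrow> Ck_on k S (\<lambda>_. c)"
  by (induction k arbitrary: c) (auto simp: frechet_derivative_const)

lemma Ck_on_linear:
  assumes "open S" "bounded_linear L" "Ck_on k S f"
  shows "Ck_on k S (\<lambda>x. L (f x))"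
  using assms(3)
proof (induction k arbitrary: f)
  case 0
  then show ?case using bounded_linear.continuous_on[OF assms(2)] by simp
next
  case (Suc k)
  show ?case
  proof (rule Ck_on_SucI)
    show "open S" by fact
    show "((\<lambda>x. L (f x)) has_derivative (\<lambda>v. L (frechet_derivative f (at x) v))) (at x)"
      if "x \<in> S" for x
      using bounded_linear.has_derivative[OF assms(2) Ck_on_has_derivative[OF assms(1) Suc.prems that]]
      by (simp add: o_def)
    show "Ck_on k S (\<lambda>x. L (frechet_derivative f (at x) v))" for v
      using Suc by simp
  qed
qed

lemma Ck_on_id: "open S \<Longrightarrow> Ck_on k S (\<lambda>x. x)"
proof (cases k)
  case (Suc k')
  assume "open S"
  then show ?thesis unfolding Suc
    by (intro Ck_on_SucI[where f' = "\<lambda>x v. v"]) (auto intro: Ck_on_const)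
qed auto

lemma Ck_on_add:
  assumes "open S" "Ck_on k S f" "Ck_on k S w"
  shows "Ck_on k S (\<lambda>x. f x + w x)"
  using assms(2,3)
proof (induction k arbitrary: f w)
  case 0
  then show ?case by (auto intro: continuous_intros)
next
  case (Suc k)
  show ?case
  proof (rule Ck_on_SucI)
    show "open S" by fact
    show "((\<lambda>x. f x + w x) has_derivative
        (\<lambda>v. frechet_derivative f (at x) v + frechet_derivative w (at x) v)) (at x)"
      if "x \<in> S" for x
      by (intro has_derivative_add Ck_on_has_derivative[OF assms(1) _ that]) (rule Suc.prems)+
    show "Ck_on k S (\<lambda>x. frechet_derivative f (at x) v + frechet_derivative w (at x) v)" for v
      using Suc by simp
  qed
qed

lemma Ck_on_mult:
  fixes f w :: "'e::euclidean_space \<Rightarrow> real"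
  assumes "open S" "Ck_on k S f" "Ck_on k S w"
  shows "Ck_on k S (\<lambda>x. f x * w x)"
  using assms(2,3)
proof (induction k arbitrary: f w)
  case 0
  then show ?case by (auto intro: continuous_intros)
next
  case (Suc k)
  show ?case
  proof (rule Ck_on_SucI)
    show "open S" by fact
    show "((\<lambda>x. f x * w x) has_derivative
        (\<lambda>v. f x * frechet_derivative w (at x) v + frechet_derivative f (at x) v * w x)) (at x)"
      if "x \<in> S" for x
      by (intro has_derivative_mult Ck_on_has_derivative[OF assms(1) _ that]) (rule Suc.prems)+
    show "Ck_on k S (\<lambda>x. f x * frechet_derivative w (at x) v + frechet_derivative f (at x) v * w x)" for v
      using Suc.prems Suc.prems[THEN Ck_on_SucD[OF assms(1)]]
      by (intro Ck_on_add[OF assms(1)] Suc.IH) auto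
  qed
qed

lemma Ck_on_sum:
  assumes "open S" "\<And>i. i \<in> I \<Longrightarrow> Ck_on k S (f i)"
  shows "Ck_on k S (\<lambda>x. \<Sum>i\<in>I. f i x)"
  using assms(2)
  by (induction I rule: infinite_finite_induct) (auto intro: Ck_on_const Ck_on_add assms(1))

text \<open>
Expanding the inner derivative in the standard basis turns the chain rule into a finite sum of products of
functions that are \<open>C\<^sup>k\<close> by the induction hypothesis.
\<close>

lemma Ck_on_compose:
  fixes f :: "'e::euclidean_space \<Rightarrow> 'd::euclidean_space" and w :: "'d \<Rightarrow> real"
  assumes "open S" "open T" "\<And>x. x \<in> S \<Longrightarrow> f x \<in> T" "Ck_on k S f" "Ck_on k T w"
  shows "Ck_on k S (\<lambda>x. w (f x))"
  using assms(4,5)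
proof (induction k arbitrary: w)
  case 0
  then show ?case using assms(3) by (auto intro: continuous_on_compose2)
next
  case (Suc k)
  let ?Df = "\<lambda>x. frechet_derivative f (at x)" and ?Dw = "\<lambda>y. frechet_derivative w (at y)"
  have expand: "?Dw (f x) (?Df x v) = (\<Sum>b\<in>Basis. (?Df x v \<bullet> b) * ?Dw (f x) b)" if "x \<in> S" for x v
  proof -
    interpret L: bounded_linear "?Dw (f x)"
      using Ck_on_has_derivative[OF assms(2) Suc.prems(2) assms(3)[OF that]]
      by (rule has_derivative_bounded_linear)
    have "?Dw (f x) (?Df x v) = ?Dw (f x) (\<Sum>b\<in>Basis. (?Df x v \<bullet> b) *\<^sub>R b)"
      by (simp add: euclidean_representation)
    also have "\<dots> = (\<Sum>b\<in>Basis. (?Df x v \<bullet> b) * ?Dw (f x) b)"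
      by (simp add: L.sum L.scaleR)
    finally show ?thesis .
  qed
  show ?case
  proof (rule Ck_on_SucI)
    show "open S" by fact
    show "((\<lambda>x. w (f x)) has_derivative (\<lambda>v. ?Dw (f x) (?Df x v))) (at x)" if "x \<in> S" for x
      using has_derivative_compose[OF Ck_on_has_derivative[OF assms(1) Suc.prems(1) that]
          Ck_on_has_derivative[OF assms(2) Suc.prems(2) assms(3)[OF that]]] .
    show "Ck_on k S (\<lambda>x. ?Dw (f x) (?Df x v))" for v
    proof (rule Ck_on_cong[OF assms(1)])
      show "Ck_on k S (\<lambda>x. \<Sum>b\<in>Basis. (?Df x v \<bullet> b) * ?Dw (f x) b)"
      proof (intro Ck_on_sum Ck_on_mult assms(1))
        show "Ck_on k S (\<lambda>x. ?Df x v \<bullet> b)" for b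
          using Suc.prems(1) by (intro Ck_on_linear[OF assms(1) bounded_linear_inner_left]) auto
        show "Ck_on k S (\<lambda>x. ?Dw (f x) b)" for b
          by (rule Suc.IH[OF Ck_on_SucD[OF assms(1) Suc.prems(1)]]) (use Suc.prems(2) in simp)
      qed
    qed (simp add: expand)
  qed
qed

section \<open>A smooth bump function\<close>

text \<open>
The functions \<open>t\<^sup>-\<^sup>n exp (- 1 / t)\<close>, continued by 0 to \<open>t \<le> 0\<close>. Taken together over all \<open>n\<close> their span is closed under
differentiation, which makes their smoothness a simple induction.
\<close>

definition flat_exp :: "nat \<Rightarrow> real \<Rightarrow> real" where
  "flat_exp n t = (if t > 0 then (1 / t) ^ n * exp (- (1 / t)) else 0)"

lemma flat_exp_tendsto_0: "((\<lambda>t. flat_exp n t) \<longlongrightarrow> 0) (at_right 0)"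
proof -
  have "((\<lambda>t. inverse t ^ n / exp (inverse t)) \<longlongrightarrow> (0::real)) (at_right 0)"
    by (rule filterlim_compose[OF tendsto_power_div_exp_0 filterlim_inverse_at_top_right])
  then show ?thesis
    by (rule Lim_transform_eventually)
      (auto simp: flat_exp_def eventually_at_right_field exp_minus field_simps intro!: exI[of _ 1])
qed

lemma flat_exp_has_derivative:
  "(flat_exp n has_real_derivative flat_exp (n + 2) t - n * flat_exp (n + 1) t) (at t)"
proof -
  consider "t > 0" | "t < 0" | "t = 0" by linarith
  then show ?thesis
  proof cases
    case 1
    have "((\<lambda>t. (1 / t) ^ n * exp (- (1 / t))) has_real_derivative
        flat_exp (n + 2) t - n * flat_exp (n + 1) t) (at t)"
    proof (rule DERIV_cong)
      show "((\<lambda>t. (1 / t) ^ n * exp (- (1 / t))) has_real_derivative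
          (n * (1 / t) ^ (n - 1) * (- 1 / t\<^sup>2)) * exp (- (1 / t))
            + (1 / t) ^ n * (exp (- (1 / t)) * (1 / t\<^sup>2))) (at t)"
        using 1 by (auto intro!: derivative_eq_intros simp: power2_eq_square)
      show "(n * (1 / t) ^ (n - 1) * (- 1 / t\<^sup>2)) * exp (- (1 / t))
          + (1 / t) ^ n * (exp (- (1 / t)) * (1 / t\<^sup>2))
        = flat_exp (n + 2) t - n * flat_exp (n + 1) t"
        using 1 by (cases n) (auto simp: flat_exp_def field_simps power2_eq_square)
    qed
    then show ?thesis
      by (rule has_field_derivative_transform_within_open[where S = "{0<..}"])
        (use 1 in \<open>auto simp: flat_exp_def\<close>)
  next
    case 2
    have "((\<lambda>t. 0) has_real_derivative flat_exp (n + 2) t - n * flat_exp (n + 1) t) (at t)"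
      using 2 by (simp add: flat_exp_def)
    then show ?thesis
      by (rule has_field_derivative_transform_within_open[where S = "{..<0}"])
        (use 2 in \<open>auto simp: flat_exp_def\<close>)
  next
    case 3
    have "((\<lambda>h. (flat_exp n (0 + h) - flat_exp n 0) / h) \<longlongrightarrow> 0) (at_right 0)"
      by (rule Lim_transform_eventually[OF flat_exp_tendsto_0[of "n + 1"]])
        (auto simp: flat_exp_def eventually_at_right_field intro!: exI[of _ 1])
    moreover have "((\<lambda>h. (flat_exp n (0 + h) - flat_exp n 0) / h) \<longlongrightarrow> 0) (at_left 0)"
      by (rule Lim_transform_eventually[OF tendsto_const])
        (auto simp: flat_exp_def eventually_at_left_field intro!: exI[of _ "-1"])
    ultimately show ?thesis
      unfolding DERIV_def 3 by (simp add: filterlim_split_at flat_exp_def)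
  qed
qed

lemma Ck_on_flat_exp: "Ck_on k UNIV (flat_exp n)"
proof (induction k arbitrary: n)
  case 0
  show ?case
    using DERIV_isCont[OF flat_exp_has_derivative]
    by (simp only: Ck_on.simps continuous_on_eq_continuous_at[OF open_UNIV]) blast
next
  case (Suc k)
  show ?case
  proof (rule Ck_on_SucI)
    show "(flat_exp n has_derivative (\<lambda>v. (flat_exp (n + 2) t + (- n) * flat_exp (n + 1) t) * v)) (at t)" for t
      using flat_exp_has_derivative[of n t] by (simp add: has_field_derivative_def)
    show "Ck_on k UNIV (\<lambda>t. (flat_exp (n + 2) t + (- n) * flat_exp (n + 1) t) * v)" for v :: real
      by (intro Ck_on_mult Ck_on_add Ck_on_const Suc.IH) auto
  qed auto
qed

definition bump :: "'e::euclidean_space \<Rightarrow> real \<Rightarrow> 'e \<Rightarrow> real" where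
  "bump x0 r x = flat_exp 0 (r\<^sup>2 - (x - x0) \<bullet> (x - x0))"

lemma Ck_on_bump:
  fixes x0 :: "'e::euclidean_space"
  shows "Ck_on k UNIV (bump x0 r)"
proof -
  have "Ck_on k UNIV (\<lambda>x. (x - x0) \<bullet> b)" for b :: 'e
  proof -
    have "Ck_on k UNIV (\<lambda>x. x \<bullet> b + (- (x0 \<bullet> b)))"
      by (intro Ck_on_add Ck_on_linear[OF _ bounded_linear_inner_left] Ck_on_id Ck_on_const) auto
    then show ?thesis by (simp add: inner_diff_left)
  qed
  then have "Ck_on k UNIV (\<lambda>x. r\<^sup>2 + (-1) * (\<Sum>b\<in>Basis. ((x - x0) \<bullet> b) * ((x - x0) \<bullet> b)))"
    by (intro Ck_on_add Ck_on_mult Ck_on_sum Ck_on_const) auto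
  moreover have "bump x0 r = (\<lambda>x. flat_exp 0 (r\<^sup>2 + (-1) * (\<Sum>b\<in>Basis. ((x - x0) \<bullet> b) * ((x - x0) \<bullet> b))))"
    by (rule ext) (subst bump_def, subst euclidean_inner, simp)
  ultimately show ?thesis
    using Ck_on_compose[OF open_UNIV open_UNIV _ _ Ck_on_flat_exp] by simp
qed

lemma bump_pos: "r > 0 \<Longrightarrow> bump x0 r x0 > 0"
  by (simp add: bump_def flat_exp_def)

lemma bump_zero: "r > 0 \<Longrightarrow> x \<notin> cball x0 r \<Longrightarrow> bump x0 r x = 0"
proof -
  assume "r > 0" "x \<notin> cball x0 r"
  then have "r < norm (x - x0)" by (simp add: dist_norm norm_minus_commute)
  then have "r\<^sup>2 < (norm (x - x0))\<^sup>2" using \<open>r > 0\<close> by (intro power_strict_mono) auto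
  then show ?thesis by (simp add: bump_def flat_exp_def power2_norm_eq_inner)
qed


section \<open>Smooth functions and vector fields supported in a chart\<close>

lemma atlas_chart:
  assumes "smooth_atlas A" "(U, \<psi>) \<in> A"
  shows "open U" "open (\<psi> ` U)" "continuous_on U \<psi>" "continuous_on (\<psi> ` U) (inv_into U \<psi>)"
    "\<And>q. q \<in> U \<Longrightarrow> inv_into U \<psi> (\<psi> q) = q"
    "\<And>x. x \<in> \<psi> ` U \<Longrightarrow> inv_into U \<psi> x \<in> U"
    "\<And>x. x \<in> \<psi> ` U \<Longrightarrow> \<psi> (inv_into U \<psi> x) = x"
proof -
  have *: "open U \<and> open (\<psi> ` U) \<and> homeomorphism U (\<psi> ` U) \<psi> (inv_into U \<psi>)"
    using assms unfolding smooth_atlas_def by fast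
  then show "open U" "open (\<psi> ` U)" by auto
  from * have h: "homeomorphism U (\<psi> ` U) \<psi> (inv_into U \<psi>)" by auto
  then show "continuous_on U \<psi>" "continuous_on (\<psi> ` U) (inv_into U \<psi>)"
    by (auto simp: homeomorphism_def)
  show "inv_into U \<psi> (\<psi> q) = q" if "q \<in> U" for q using h that by (rule homeomorphism_apply1)
  show "inv_into U \<psi> x \<in> U" if "x \<in> \<psi> ` U" for x using that by (rule inv_into_into)
  show "\<psi> (inv_into U \<psi> x) = x" if "x \<in> \<psi> ` U" for x using that by (rule f_inv_into_f)
qed

lemma smooth_funD:
  assumes "smooth_fun A u" "(U, \<psi>) \<in> A"
  shows "Ck_on k (\<psi> ` U) (\<lambda>x. u (inv_into U \<psi> x))"
  using assms unfolding smooth_fun_def smooth_on_def by (fastforce simp: o_def)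

lemma smooth_funI:
  assumes "\<And>U \<psi> k. (U, \<psi>) \<in> A \<Longrightarrow> Ck_on k (\<psi> ` U) (\<lambda>x. u (inv_into U \<psi> x))"
  shows "smooth_fun A u"
  using assms unfolding smooth_fun_def smooth_on_def by (auto simp: o_def)

lemma smooth_fun_const: "smooth_atlas A \<Longrightarrow> smooth_fun A (\<lambda>_. c)"
  by (intro smooth_funI Ck_on_const) (rule atlas_chart)

lemma smooth_fun_add:
  "smooth_atlas A \<Longrightarrow> smooth_fun A u \<Longrightarrow> smooth_fun A w \<Longrightarrow> smooth_fun A (u + w)"
  by (rule smooth_funI) (simp only: plus_fun_apply, intro Ck_on_add atlas_chart smooth_funD)

lemma smooth_fun_mult:
  "smooth_atlas A \<Longrightarrow> smooth_fun A u \<Longrightarrow> smooth_fun A w \<Longrightarrow> smooth_fun A (u * w)"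
  by (rule smooth_funI) (simp only: times_fun_apply, intro Ck_on_mult atlas_chart smooth_funD)

text \<open>
The image of \<open>K\<close> in the manifold is compact, hence closed because the manifold is Hausdorff. So the
manifold is covered by the chart, where the function is smooth by the transition maps, and by the
complement of the image of \<open>K\<close>, where it vanishes.
\<close>

lemma smooth_fun_extend_by_zero:
  assumes A: "smooth_atlas A" and U: "(U, \<psi>) \<in> A"
    and F: "\<And>k. Ck_on k (\<psi> ` U) F"
    and K: "compact K" "K \<subseteq> \<psi> ` U" "\<And>x. x \<in> \<psi> ` U - K \<Longrightarrow> F x = 0"
  shows "smooth_fun A (\<lambda>q. if q \<in> U then F (\<psi> q) else 0)" (is "smooth_fun A ?u")
proof (rule smooth_funI)
  fix V \<theta> k assume V: "(V, \<theta>) \<in> A"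
  let ?i = "inv_into V \<theta>" and ?j = "inv_into U \<psi>"
  note cU = atlas_chart[OF A U] and cV = atlas_chart[OF A V]
  have "compact (?j ` K)"
    by (rule compact_continuous_image[OF continuous_on_subset[OF cU(4) K(2)] K(1)])
  then have clK: "closed (?j ` K)" by (rule compact_imp_closed)
  show "Ck_on k (\<theta> ` V) (\<lambda>x. ?u (?i x))"
  proof (rule Ck_on_local[OF cV(2)])
    fix y assume y: "y \<in> \<theta> ` V"
    show "\<exists>T. open T \<and> y \<in> T \<and> Ck_on k T (\<lambda>x. ?u (?i x))"
    proof (cases "?i y \<in> U")
      case True
      let ?T = "\<theta> ` V \<inter> ?i -` U"
      have oT: "open ?T"
        by (rule continuous_open_preimage[OF cV(4) cV(2) cU(1)])
      have eq: "?T = \<theta> ` (V \<inter> U)"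
      proof (intro equalityI subsetI)
        fix x assume "x \<in> ?T"
        then show "x \<in> \<theta> ` (V \<inter> U)"
          using cV(6,7)[of x] by (intro image_eqI[of _ _ "?i x"]) auto
      next
        fix x assume "x \<in> \<theta> ` (V \<inter> U)"
        then show "x \<in> ?T" using cV(5) by auto
      qed
      have "smooth_on (\<theta> ` (V \<inter> U)) (\<psi> \<circ> ?i)"
        using A V U unfolding smooth_atlas_def by fast
      then have tr: "Ck_on k ?T (\<lambda>x. \<psi> (?i x))"
        unfolding eq smooth_on_def by (simp add: o_def)
      have "Ck_on k ?T (\<lambda>x. F (\<psi> (?i x)))"
        by (rule Ck_on_compose[OF oT cU(2) _ tr F]) auto
      then have "Ck_on k ?T (\<lambda>x. ?u (?i x))"
        by (rule Ck_on_cong[OF oT, rotated]) auto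
      then show ?thesis using oT y True by blast
    next
      case False
      let ?T = "\<theta> ` V \<inter> ?i -` (- (?j ` K))"
      have oT: "open ?T"
        by (rule continuous_open_preimage[OF cV(4) cV(2)]) (use clK in auto)
      have "?u (?i x) = 0" if "x \<in> ?T" for x
      proof (cases "?i x \<in> U")
        case True
        then have "\<psi> (?i x) \<notin> K"
          using that cU(5)[OF True] by (metis ComplD IntD2 image_eqI vimageD)
        then show ?thesis using K(3) True by auto
      qed auto
      then have "Ck_on k ?T (\<lambda>x. ?u (?i x))"
        using Ck_on_cong[OF oT _ Ck_on_const[OF oT, of k 0], of "\<lambda>x. ?u (?i x)"] by simp
      moreover have "?i y \<notin> ?j ` K"
      proof
        assume "?i y \<in> ?j ` K"
        then obtain x where "x \<in> K" "?i y = ?j x" by auto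
        then show False using False K(2) cU(6)[of x] by auto
      qed
      ultimately show ?thesis using oT y by blast
    qed
  qed
qed

text \<open>
  The coordinate field in direction \<open>c\<close>, cut off by a function \<open>\<rho>\<close> of the coordinates. The value 0 on
  non-smooth functions is the convention for tangent vectors.
\<close>

definition chart_field ::
  "('a::{t2_space,second_countable_topology}, 'e::euclidean_space) atlas \<Rightarrow> 'a set \<Rightarrow> ('a \<Rightarrow> 'e) \<Rightarrow>
     ('e \<Rightarrow> real) \<Rightarrow> 'e \<Rightarrow> 'a vfield" where
  "chart_field A U \<psi> \<rho> c = (\<lambda>q u. if smooth_fun A u \<and> q \<in> U
     then \<rho> (\<psi> q) * frechet_derivative (\<lambda>x. u (inv_into U \<psi> x)) (at (\<psi> q)) c else 0)"

lemma smooth_fun_has_derivative: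
  assumes "smooth_atlas A" "(U, \<psi>) \<in> A" "smooth_fun A u" "q \<in> U"
  shows "((\<lambda>x. u (inv_into U \<psi> x)) has_derivative
    frechet_derivative (\<lambda>x. u (inv_into U \<psi> x)) (at (\<psi> q))) (at (\<psi> q))"
  by (rule Ck_on_has_derivative[OF atlas_chart(2)[OF assms(1,2)] smooth_funD[OF assms(3,2)]])
    (use assms(4) in auto)

lemma chart_field_in_tangent_space:
  assumes A: "smooth_atlas A" and U: "(U, \<psi>) \<in> A"
  shows "chart_field A U \<psi> \<rho> c q \<in> tangent_space A q"
proof (cases "q \<in> U")
  case q: True
  let ?j = "inv_into U \<psi>"
  let ?d = "\<lambda>u. frechet_derivative (\<lambda>x. u (?j x)) (at (\<psi> q))"
  note hd = smooth_fun_has_derivative[OF A U _ q]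
  have jq: "?j (\<psi> q) = q" using atlas_chart(5)[OF A U q] .
  have sc: "smooth_fun A (\<lambda>q. s * u q)" if "smooth_fun A u" for s u
    using smooth_fun_mult[OF A smooth_fun_const[OF A] that, of s] by (simp add: times_fun_def)
  have add: "?d (u + w) c = ?d u c + ?d w c" if "smooth_fun A u" "smooth_fun A w" for u w
    using fun_cong[OF frechet_derivative_at[OF has_derivative_add[OF hd[OF that(1)] hd[OF that(2)]]], of c]
    by simp
  have scale: "?d (\<lambda>q. s * u q) c = s * ?d u c" if "smooth_fun A u" for s u
    using fun_cong[OF frechet_derivative_at[OF has_derivative_mult_right[OF hd[OF that], of s]], of c]
    by simp
  have prod: "?d (u * w) c = ?d u c * w q + u q * ?d w c" if "smooth_fun A u" "smooth_fun A w" for u w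
    using fun_cong[OF frechet_derivative_at[OF has_derivative_mult[OF hd[OF that(1)] hd[OF that(2)]]], of c]
    by (simp add: jq)
  have v: "chart_field A U \<psi> \<rho> c q u = \<rho> (\<psi> q) * ?d u c" if "smooth_fun A u" for u
    using that q by (simp add: chart_field_def)
  have v0: "chart_field A U \<psi> \<rho> c q u = 0" if "\<not> smooth_fun A u" for u
    using that by (simp add: chart_field_def)
  show ?thesis
    unfolding tangent_space_def mem_Collect_eq
  proof (intro conjI allI impI)
    show "chart_field A U \<psi> \<rho> c q (u + w) = chart_field A U \<psi> \<rho> c q u + chart_field A U \<psi> \<rho> c q w"
      if "smooth_fun A u" "smooth_fun A w" for u w
      unfolding v[OF that(1)] v[OF that(2)] v[OF smooth_fun_add[OF A that]] add[OF that]
      by (rule distrib_left)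
    show "chart_field A U \<psi> \<rho> c q (u * w)
        = chart_field A U \<psi> \<rho> c q u * w q + u q * chart_field A U \<psi> \<rho> c q w"
      if "smooth_fun A u" "smooth_fun A w" for u w
      unfolding v[OF that(1)] v[OF that(2)] v[OF smooth_fun_mult[OF A that]] prod[OF that]
      by (simp add: algebra_simps)
    show "chart_field A U \<psi> \<rho> c q (\<lambda>q. s * u q) = s * chart_field A U \<psi> \<rho> c q u"
      if "smooth_fun A u" for s u
      unfolding v[OF that] v[OF sc[OF that]] scale[OF that] by simp
  qed (rule v0)
qed (simp add: tangent_space_def chart_field_def)

lemma vector_field_chart_field:
  assumes A: "smooth_atlas A" and U: "(U, \<psi>) \<in> A"
    and \<rho>: "\<And>k. Ck_on k UNIV \<rho>"
    and K: "compact K" "K \<subseteq> \<psi> ` U" "\<And>x. x \<notin> K \<Longrightarrow> \<rho> x = 0"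
  shows "vector_field A (chart_field A U \<psi> \<rho> c)"
  unfolding vector_field_def
proof (intro conjI allI impI chart_field_in_tangent_space[OF A U])
  fix u assume u: "smooth_fun A u"
  note oU = atlas_chart(2)[OF A U]
  have "smooth_fun A (\<lambda>q. if q \<in> U
      then \<rho> (\<psi> q) * frechet_derivative (\<lambda>x. u (inv_into U \<psi> x)) (at (\<psi> q)) c else 0)"
  proof (rule smooth_fun_extend_by_zero[OF A U _ K(1,2)])
    show "Ck_on k (\<psi> ` U) (\<lambda>x. \<rho> x * frechet_derivative (\<lambda>x. u (inv_into U \<psi> x)) (at x) c)" for k
      using smooth_funD[OF u U, of "Suc k"]
      by (intro Ck_on_mult[OF oU] Ck_on_subset[OF oU open_UNIV _ \<rho>]) auto
  qed (use K(3) in auto)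
  then show "smooth_fun A (vderiv (chart_field A U \<psi> \<rho> c) u)"
    using u by (simp add: vderiv_def chart_field_def)
qed

text \<open>
The field is tested on the cut-off of the linear coordinate \<open>(x - \<psi> p) \<bullet> c\<close>. That coordinate vanishes at
\<open>p\<close>, so the derivative of the cut-off factor does not contribute.
\<close>

lemma chart_field_nonzero:
  assumes A: "smooth_atlas A" and U: "(U, \<psi>) \<in> A"
    and \<rho>: "\<And>k. Ck_on k UNIV \<rho>"
    and K: "compact K" "K \<subseteq> \<psi> ` U" "\<And>x. x \<notin> K \<Longrightarrow> \<rho> x = 0"
    and p: "p \<in> U" "\<rho> (\<psi> p) \<noteq> 0" and c: "c \<noteq> 0"
  shows "chart_field A U \<psi> \<rho> c p \<noteq> 0"
proof -
  let ?F = "\<lambda>x. \<rho> x * ((x - \<psi> p) \<bullet> c)"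
  let ?u = "\<lambda>q. if q \<in> U then ?F (\<psi> q) else 0"
  note ch = atlas_chart[OF A U]
  have "Ck_on k UNIV (\<lambda>x. x \<bullet> c + (- (\<psi> p \<bullet> c)))" for k
    by (intro Ck_on_add Ck_on_linear[OF _ bounded_linear_inner_left] Ck_on_id Ck_on_const) auto
  then have "Ck_on k UNIV (\<lambda>x. (x - \<psi> p) \<bullet> c)" for k
    by (simp add: inner_diff_left)
  then have CF: "Ck_on k UNIV ?F" for k
    by (intro Ck_on_mult \<rho>) auto
  have u: "smooth_fun A ?u"
    by (rule smooth_fun_extend_by_zero[OF A U Ck_on_subset[OF ch(2) open_UNIV _ CF] K(1,2)])
      (use K(3) in auto)
  have "(\<rho> has_derivative frechet_derivative \<rho> (at (\<psi> p))) (at (\<psi> p))"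
    by (rule Ck_on_has_derivative[OF open_UNIV \<rho>]) auto
  then have "(?F has_derivative
      (\<lambda>v. \<rho> (\<psi> p) * (v \<bullet> c) + frechet_derivative \<rho> (at (\<psi> p)) v * ((\<psi> p - \<psi> p) \<bullet> c))) (at (\<psi> p))"
    by (rule has_derivative_mult) (auto intro!: derivative_eq_intros)
  then have "((\<lambda>x. ?u (inv_into U \<psi> x)) has_derivative
      (\<lambda>v. \<rho> (\<psi> p) * (v \<bullet> c) + frechet_derivative \<rho> (at (\<psi> p)) v * ((\<psi> p - \<psi> p) \<bullet> c))) (at (\<psi> p))"
    by (rule has_derivative_transform_within_open[OF _ ch(2)]) (use p ch(6,7) in auto)
  from fun_cong[OF frechet_derivative_at[OF this], of c]
  have "chart_field A U \<psi> \<rho> c p ?u = \<rho> (\<psi> p) * (\<rho> (\<psi> p) * (c \<bullet> c))"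
    unfolding chart_field_def using u p by simp
  then have "chart_field A U \<psi> \<rho> c p ?u \<noteq> 0" using p(2) c by simp
  then show ?thesis by (auto simp: fun_eq_iff)
qed

lemma chart_field_linear:
  assumes A: "smooth_atlas A" and U: "(U, \<psi>) \<in> A"
  shows "chart_field A U \<psi> \<rho> (c + d) q = chart_field A U \<psi> \<rho> c q + chart_field A U \<psi> \<rho> d q"
    and "chart_field A U \<psi> \<rho> (s *\<^sub>R c) q = (\<lambda>u. s * chart_field A U \<psi> \<rho> c q u)"
proof -
  have lin: "linear (frechet_derivative (\<lambda>x. u (inv_into U \<psi> x)) (at (\<psi> q)))"
    if "smooth_fun A u" "q \<in> U" for u
    using has_derivative_linear[OF smooth_fun_has_derivative[OF A U that]] .
  show "chart_field A U \<psi> \<rho> (c + d) q = chart_field A U \<psi> \<rho> c q + chart_field A U \<psi> \<rho> d q"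
    by (rule ext) (auto simp: chart_field_def linear_add[OF lin] distrib_left)
  show "chart_field A U \<psi> \<rho> (s *\<^sub>R c) q = (\<lambda>u. s * chart_field A U \<psi> \<rho> c q u)"
    by (rule ext) (auto simp: chart_field_def linear_cmul[OF lin])
qed

text \<open>
The cut-off coordinate fields depend linearly and, at \<open>p\<close>, injectively on their direction \<open>c\<close>. Hence
the conditions on \<open>c\<close> are fewer linear equations than unknowns.
\<close>

lemma exists_vector_field_annihilated:
  fixes A :: "('a::{t2_space,second_countable_topology}, 'e::euclidean_space) atlas"
  assumes A: "smooth_atlas A"
    and I: "finite I" "card I < DIM('e)"
    and L: "\<And>i. i \<in> I \<Longrightarrow> linear_form_on (tangent_space A p) (L i)"
  shows "\<exists>W. vector_field A W \<and> W p \<noteq> 0 \<and> (\<forall>i\<in>I. L i (W p) = 0)"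
proof -
  have "p \<in> (\<Union>(U, \<psi>) \<in> A. U)"
    using A unfolding smooth_atlas_def by simp
  then obtain U \<psi> where U: "(U, \<psi>) \<in> A" "p \<in> U" by auto
  note ch = atlas_chart[OF A U(1)]
  obtain r where r: "r > 0" "cball (\<psi> p) r \<subseteq> \<psi> ` U"
    using ch(2) U(2) open_contains_cball by blast
  let ?W = "chart_field A U \<psi> (bump (\<psi> p) r)"
  have vf: "vector_field A (?W c)" for c
    by (rule vector_field_chart_field[OF A U(1) Ck_on_bump compact_cball r(2)]) (rule bump_zero[OF r(1)])
  have nz: "?W c p \<noteq> 0" if "c \<noteq> 0" for c
  proof (rule chart_field_nonzero[OF A U(1) Ck_on_bump compact_cball r(2) _ U(2) _ that])
    show "bump (\<psi> p) r (\<psi> p) \<noteq> 0"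
      using bump_pos[OF r(1), of "\<psi> p"] by simp
  qed (rule bump_zero[OF r(1)])
  have tan: "?W c p \<in> tangent_space A p" for c
    by (rule chart_field_in_tangent_space[OF A U(1)])
  define l where "l i c = L i (?W c p)" for i c
  have lin: "linear (l i)" if "i \<in> I" for i
    using L[OF that] tan unfolding l_def linear_form_on_def
    by (intro linearI) (auto simp: chart_field_linear[OF A U(1)])
  have "dim ((\<lambda>i. adjoint (l i) 1) ` I) \<le> card ((\<lambda>i. adjoint (l i) 1) ` I)"
    using I(1) by (intro dim_le_card') auto
  also have "\<dots> < DIM('e)"
    using card_image_le[OF I(1)] I(2) by (rule le_less_trans)
  finally obtain c where c: "c \<noteq> 0" "\<And>y. y \<in> span ((\<lambda>i. adjoint (l i) 1) ` I) \<Longrightarrow> orthogonal c y"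
    using orthogonal_to_subspace_exists by metis
  have "L i (?W c p) = 0" if "i \<in> I" for i
  proof -
    have "l i c \<bullet> 1 = c \<bullet> adjoint (l i) 1"
      using adjoint_works[OF lin[OF that]] by simp
    also have "\<dots> = 0"
      using c(2)[OF span_base] that by (auto simp: orthogonal_def)
    finally show ?thesis by (simp add: l_def)
  qed
  then show ?thesis using vf nz[OF c(1)] by blast
qed

section \<open>Vector fields as derivations\<close>

lemma tangent_space_add: "v \<in> tangent_space A p \<Longrightarrow> w \<in> tangent_space A p \<Longrightarrow> v + w \<in> tangent_space A p"
  by (simp add: tangent_space_def algebra_simps)

lemma tangent_space_scale: "v \<in> tangent_space A p \<Longrightarrow> (\<lambda>u. c * v u) \<in> tangent_space A p"
  by (simp add: tangent_space_def algebra_simps)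

lemma smooth_fun_minus:
  assumes "smooth_atlas A" "smooth_fun A u"
  shows "smooth_fun A (- u)"
proof -
  have "- u = (\<lambda>_. - 1) * u" by (auto simp: fun_eq_iff)
  then show ?thesis using smooth_fun_mult[OF assms(1) smooth_fun_const[OF assms(1)] assms(2)] by metis
qed

lemma smooth_fun_diff:
  "smooth_atlas A \<Longrightarrow> smooth_fun A u \<Longrightarrow> smooth_fun A w \<Longrightarrow> smooth_fun A (u - w)"
  using smooth_fun_add[of A u "- w"] smooth_fun_minus[of A w] by simp

lemma vector_field_smooth: "vector_field A X \<Longrightarrow> smooth_fun A u \<Longrightarrow> smooth_fun A (vderiv X u)"
  by (simp add: vector_field_def)

lemma vderiv_left_simps [simp]:
  "vderiv (X + Y) u = vderiv X u + vderiv Y u"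
  "vderiv (X - Y) u = vderiv X u - vderiv Y u"
  "vderiv (- X) u = - vderiv X u"
  "vderiv (f *\<^sub>f X) u = f * vderiv X u"
  by (auto simp: vderiv_def fscale_def fun_eq_iff)

lemma vector_field_add:
  assumes "smooth_atlas A" "vector_field A X" "vector_field A Y"
  shows "vector_field A (X + Y)"
  using assms by (auto simp: vector_field_def intro!: tangent_space_add smooth_fun_add)

lemma vector_field_fscale:
  assumes "smooth_atlas A" "smooth_fun A f" "vector_field A X"
  shows "vector_field A (f *\<^sub>f X)"
proof -
  have "(f *\<^sub>f X) p \<in> tangent_space A p" for p
    using assms(3) tangent_space_scale[of "X p" A p "f p"] by (simp add: fscale_def vector_field_def)
  then show ?thesis using assms by (auto simp: vector_field_def intro!: smooth_fun_mult)
qed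

lemma fscale_simps:
  "(f + f') *\<^sub>f X = f *\<^sub>f X + f' *\<^sub>f X"
  "f *\<^sub>f (X + Y) = f *\<^sub>f X + f *\<^sub>f Y"
  "(f - f') *\<^sub>f X = f *\<^sub>f X - f' *\<^sub>f X"
  "f *\<^sub>f (X - Y) = f *\<^sub>f X - f *\<^sub>f Y"
  "(- f) *\<^sub>f X = - (f *\<^sub>f X)"
  "f *\<^sub>f (- X) = - (f *\<^sub>f X)"
  "f *\<^sub>f (f' *\<^sub>f X) = (f * f') *\<^sub>f X"
  "0 *\<^sub>f X = 0" "1 *\<^sub>f X = X" "f *\<^sub>f 0 = 0"
  by (auto simp: fscale_def fun_eq_iff algebra_simps)

lemma uminus_eq_fscale: "- X = (\<lambda>_. - 1) *\<^sub>f X"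
  by (auto simp: fscale_def fun_eq_iff)

lemma vector_field_minus: "smooth_atlas A \<Longrightarrow> vector_field A X \<Longrightarrow> vector_field A (- X)"
  unfolding uminus_eq_fscale by (intro vector_field_fscale smooth_fun_const)

lemma vector_field_diff:
  "smooth_atlas A \<Longrightarrow> vector_field A X \<Longrightarrow> vector_field A Y \<Longrightarrow> vector_field A (X - Y)"
  using vector_field_add[of A X "- Y"] vector_field_minus[of A Y] by simp

lemma vector_field_0: "smooth_atlas A \<Longrightarrow> vector_field A 0"
  by (auto simp: vector_field_def tangent_space_def vderiv_def zero_fun_def smooth_fun_const)

lemma vderiv_add:
  "vector_field A X \<Longrightarrow> smooth_fun A u \<Longrightarrow> smooth_fun A w \<Longrightarrow> vderiv X (u + w) = vderiv X u + vderiv X w"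
  by (auto simp: vector_field_def tangent_space_def vderiv_def)

lemma vderiv_mult:
  "vector_field A X \<Longrightarrow> smooth_fun A u \<Longrightarrow> smooth_fun A w \<Longrightarrow> vderiv X (u * w) = vderiv X u * w + u * vderiv X w"
  by (auto simp: vector_field_def tangent_space_def vderiv_def)

lemma vderiv_minus:
  assumes "vector_field A X" "smooth_fun A u"
  shows "vderiv X (- u) = - vderiv X u"
proof
  fix p
  have "X p (\<lambda>q. (-1) * u q) = (-1) * X p u"
    using assms unfolding vector_field_def tangent_space_def by blast
  moreover have "- u = (\<lambda>q. (-1) * u q)" by auto
  ultimately show "vderiv X (- u) p = (- vderiv X u) p" by (simp add: vderiv_def)
qed

lemma vderiv_diff:
  "smooth_atlas A \<Longrightarrow> vector_field A X \<Longrightarrow> smooth_fun A u \<Longrightarrow> smooth_fun A w \<Longrightarrow> vderiv X (u - w) = vderiv X u - vderiv X w"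
  using vderiv_add[of A X u "- w"] smooth_fun_minus[of A w] vderiv_minus[of A X w] by simp

lemma vderiv_0: "smooth_atlas A \<Longrightarrow> vector_field A X \<Longrightarrow> vderiv X 0 = 0"
  using vderiv_add[of A X 0 0] smooth_fun_const[of A 0] by (simp add: zero_fun_def[symmetric])

lemma vderiv_1:
  assumes "smooth_atlas A" "vector_field A X"
  shows "vderiv X 1 = 0"
proof -
  have "smooth_fun A 1" unfolding one_fun_def by (rule smooth_fun_const[OF assms(1)])
  from vderiv_mult[OF assms(2) this this] show ?thesis by simp
qed

lemma vderiv_lie_bracket:
  "smooth_fun A u \<Longrightarrow> vderiv (lie_bracket A X Y) u = vderiv X (vderiv Y u) - vderiv Y (vderiv X u)"
  by (auto simp: vderiv_def lie_bracket_def)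

lemma lie_bracket_jacobi:
  assumes A: "smooth_atlas A" and X: "vector_field A X" and Y: "vector_field A Y" and Z: "vector_field A Z"
  shows "lie_bracket A X (lie_bracket A Y Z) + lie_bracket A Y (lie_bracket A Z X)
       + lie_bracket A Z (lie_bracket A X Y) = 0" (is "?J = 0")
proof (intro ext)
  fix p u
  show "?J p u = 0 p u"
  proof (cases "smooth_fun A u")
    case True
    note s = vector_field_smooth[OF X] vector_field_smooth[OF Y] vector_field_smooth[OF Z]
    have "vderiv ?J u = 0"
      using True by (simp add: vderiv_lie_bracket vderiv_diff[OF A] X Y Z s)
    from fun_cong[OF this, of p] show ?thesis by (simp add: vderiv_def)
  qed (simp add: lie_bracket_def)
qed

section \<open>Curvature of metric torsion-free connections\<close>

text \<open>
The curvature symmetries are needed twice: for the Levi-Civita connection on all vector fields, and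
for the connection that it induces on the leaves of \<open>ker \<eta>\<close>. The class \<open>V\<close> of fields and the pairing
\<open>G\<close> are therefore parameters.
\<close>

locale metric_connection =
  fixes A :: "('a::{t2_space,second_countable_topology}, 'e::euclidean_space) atlas"
    and G :: "'a vfield \<Rightarrow> 'a vfield \<Rightarrow> ('a \<Rightarrow> real)"
    and V :: "'a vfield \<Rightarrow> bool"
    and N :: "'a connection"
  assumes atlas: "smooth_atlas A"
    and V_vector_field: "V X \<Longrightarrow> vector_field A X"
    and V_add: "V X \<Longrightarrow> V Y \<Longrightarrow> V (X + Y)"
    and V_diff: "V X \<Longrightarrow> V Y \<Longrightarrow> V (X - Y)"
    and V_N: "V X \<Longrightarrow> V Y \<Longrightarrow> V (N X Y)"
    and N_diff_left: "V X \<Longrightarrow> V Y \<Longrightarrow> V Z \<Longrightarrow> N (X - Y) Z = N X Z - N Y Z"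
    and N_diff_right: "V X \<Longrightarrow> V Y \<Longrightarrow> V Z \<Longrightarrow> N X (Y - Z) = N X Y - N X Z"
    and torsion_free: "V X \<Longrightarrow> V Y \<Longrightarrow> lie_bracket A X Y = N X Y - N Y X"
    and G_smooth: "V X \<Longrightarrow> V Y \<Longrightarrow> smooth_fun A (G X Y)"
    and G_add: "V X \<Longrightarrow> V Y \<Longrightarrow> V Z \<Longrightarrow> G (X + Y) Z = G X Z + G Y Z"
    and G_diff: "V X \<Longrightarrow> V Y \<Longrightarrow> V Z \<Longrightarrow> G (X - Y) Z = G X Z - G Y Z"
    and G_commute: "V X \<Longrightarrow> V Y \<Longrightarrow> G X Y = G Y X"
    and metric: "V X \<Longrightarrow> V Y \<Longrightarrow> V Z \<Longrightarrow> vderiv X (G Y Z) = G (N X Y) Z + G Y (N X Z)"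
begin

definition K :: "'a vfield \<Rightarrow> 'a vfield \<Rightarrow> 'a vfield \<Rightarrow> 'a vfield \<Rightarrow> ('a \<Rightarrow> real)" where
  "K X Y Z W = G (curvature A N X Y Z) W"

lemma curvature_expand:
  assumes "V X" "V Y" "V Z"
  shows "curvature A N X Y Z = N X (N Y Z) - N Y (N X Z) - (N (N X Y) Z - N (N Y X) Z)"
  using assms by (simp add: curvature_def torsion_free N_diff_left V_N)

lemma V_curvature: "V X \<Longrightarrow> V Y \<Longrightarrow> V Z \<Longrightarrow> V (curvature A N X Y Z)"
  by (simp add: curvature_expand V_diff V_N)

lemma K_expand:
  assumes "V X" "V Y" "V Z" "V W"
  shows "K X Y Z W = G (N X (N Y Z)) W - G (N Y (N X Z)) W - (G (N (N X Y) Z) W - G (N (N Y X) Z) W)"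
  using assms by (simp add: K_def curvature_expand G_diff V_N V_diff)

lemma K_skew_left: "V X \<Longrightarrow> V Y \<Longrightarrow> V Z \<Longrightarrow> V W \<Longrightarrow> K Y X Z W = - K X Y Z W"
  by (simp add: K_expand)

lemma K_skew_right:
  assumes V: "V X" "V Y" "V Z" "V W"
  shows "K X Y W Z = - K X Y Z W"
proof -
  note smooth = G_smooth V_N V
  have 0: "vderiv (lie_bracket A X Y) (G Z W) = vderiv X (vderiv Y (G Z W)) - vderiv Y (vderiv X (G Z W))"
    by (intro vderiv_lie_bracket smooth)
  have 1: "vderiv (lie_bracket A X Y) (G Z W)
      = G (N (N X Y) Z) W + G Z (N (N X Y) W) - (G (N (N Y X) Z) W + G Z (N (N Y X) W))"
    by (simp add: torsion_free V V_N metric)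
  have 2: "vderiv X (vderiv Y (G Z W)) = G (N X (N Y Z)) W + G (N Y Z) (N X W)
      + (G (N X Z) (N Y W) + G Z (N X (N Y W)))"
    by (simp add: metric V V_N vderiv_add[OF V_vector_field[OF V(1)] smooth(1) smooth(1)])
  have 3: "vderiv Y (vderiv X (G Z W)) = G (N Y (N X Z)) W + G (N X Z) (N Y W)
      + (G (N Y Z) (N X W) + G Z (N Y (N X W)))"
    by (simp add: metric V V_N vderiv_add[OF V_vector_field[OF V(2)] smooth(1) smooth(1)])
  have "G Z W' = G W' Z" if "V W'" for W'
    by (rule G_commute[OF V(3) that])
  note c = this[OF V_N[OF V(1) V_N[OF V(2,4)]]] this[OF V_N[OF V(2) V_N[OF V(1,4)]]]
    this[OF V_N[OF V_N[OF V(1,2)] V(4)]] this[OF V_N[OF V_N[OF V(2,1)] V(4)]]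
  show ?thesis
  proof
    fix p
    show "K X Y W Z p = (- K X Y Z W) p"
      using fun_cong[OF 0[unfolded 1 2 3 c], of p]
      unfolding K_expand[OF V] K_expand[OF V(1,2,4,3)] by simp
  qed
qed

lemma K_bianchi:
  assumes V: "V X" "V Y" "V Z" "V W"
  shows "K X Y Z W + K Y Z X W + K Z X Y W = 0"
proof -
  have "curvature A N X Y Z + curvature A N Y Z X + curvature A N Z X Y
    = lie_bracket A X (lie_bracket A Y Z) + lie_bracket A Y (lie_bracket A Z X)
       + lie_bracket A Z (lie_bracket A X Y)"
    by (simp add: curvature_expand torsion_free V V_N V_diff N_diff_left N_diff_right algebra_simps)
  also have "\<dots> = 0"
    using V V_vector_field by (intro lie_bracket_jacobi atlas) auto
  finally have "G (curvature A N X Y Z + curvature A N Y Z X + curvature A N Z X Y) W = G (X - X) W"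
    by simp
  then show ?thesis
    by (simp only: G_add G_diff V V_curvature V_add K_def) simp
qed

text \<open>
The sum of the four Bianchi identities for the cyclic shifts of \<open>(X, Y, Z, W)\<close>.
\<close>

lemma K_pair_symmetry:
  assumes V: "V X" "V Y" "V Z" "V W"
  shows "K X Y Z W = K Z W X Y"
proof
  fix p
  note ev = fun_cong[where x = p]
  note b = K_bianchi[THEN ev, simplified] and l = K_skew_left[THEN ev, simplified]
    and r = K_skew_right[THEN ev, simplified]
  show "K X Y Z W p = K Z W X Y p"
    using b[OF V(1,2,3,4)] b[OF V(2,3,4,1)] b[OF V(3,4,1,2)] b[OF V(4,1,2,3)]
      l[OF V(1,3,4,2)] l[OF V(2,4,1,3)] l[OF V(1,4,2,3)] l[OF V(2,4,3,1)] l[OF V(1,3,2,4)] l[OF V(1,4,3,2)]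
      r[OF V(1,2,3,4)] r[OF V(2,3,4,1)] r[OF V(2,3,1,4)] r[OF V(3,4,1,2)] r[OF V(4,1,2,3)]
      r[OF V(1,3,2,4)] r[OF V(2,4,1,3)] r[OF V(3,1,2,4)] r[OF V(4,2,1,3)] r[OF V(4,2,3,1)] r[OF V(1,4,2,3)]
    by linarith
qed

end

section \<open>The structure tensors of an almost cosymplectic (\<open>\<kappa>\<close>,\<open>\<mu>\<close>)-space\<close>

locale almost_cosymplectic_kappa_mu =
  fixes A :: "('a::{t2_space,second_countable_topology}, 'e::euclidean_space) atlas"
    and \<phi> :: "'a endo" and \<xi> :: "'a vfield" and \<eta> :: "'a oneform" and g :: "'a bilin"
    and nabla :: "'a connection"
    and \<kappa> \<mu> :: "'a \<Rightarrow> real"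
  assumes almost_cosymplectic: "almost_cosymplectic A \<phi> \<xi> \<eta> g"
    and levi_civita: "levi_civita A g nabla"
    and kappa_mu: "kappa_mu_space A \<phi> \<xi> \<eta> g nabla \<kappa> \<mu>"
    and dim: "DIM('e) \<ge> 5"
    and kappa_neg: "\<And>p. \<kappa> p < 0"
begin

abbreviation "vf \<equiv> vector_field A"
abbreviation "sm \<equiv> smooth_fun A"
abbreviation "G \<equiv> ap2 g"
abbreviation "F \<equiv> ap1 \<phi>"
abbreviation "E \<equiv> ap1 \<eta>"
abbreviation "N \<equiv> nabla"

lemma acm: "almost_contact_metric A \<phi> \<xi> \<eta> g"
  using almost_cosymplectic by (simp add: almost_cosymplectic_def)

lemma atlas: "smooth_atlas A"
  using acm by (simp add: almost_contact_metric_def)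

lemma vf_xi [simp]: "vf \<xi>"
  using acm by (simp add: almost_contact_metric_def)

lemma sm_kappa [simp]: "sm \<kappa>" and sm_mu [simp]: "sm \<mu>"
  using kappa_mu by (simp_all add: kappa_mu_space_def)

lemma sm_simps [simp]:
  "sm (\<lambda>_. c)" "sm u \<Longrightarrow> sm w \<Longrightarrow> sm (u + w)" "sm u \<Longrightarrow> sm w \<Longrightarrow> sm (u - w)"
  "sm u \<Longrightarrow> sm (- u)" "sm u \<Longrightarrow> sm w \<Longrightarrow> sm (u * w)" "sm 0" "sm 1"
  using smooth_fun_const[OF atlas, of 0] smooth_fun_const[OF atlas, of 1]
  by (simp_all add: atlas smooth_fun_const smooth_fun_add smooth_fun_diff smooth_fun_minus smooth_fun_mult
      zero_fun_def one_fun_def)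

lemma vf_simps [simp]:
  "vf X \<Longrightarrow> vf Y \<Longrightarrow> vf (X + Y)" "vf X \<Longrightarrow> vf Y \<Longrightarrow> vf (X - Y)" "vf X \<Longrightarrow> vf (- X)"
  "vf 0" "sm f \<Longrightarrow> vf X \<Longrightarrow> vf (f *\<^sub>f X)"
  by (simp_all add: atlas vector_field_add vector_field_diff vector_field_minus vector_field_0 vector_field_fscale)

lemma sm_G [simp]: "vf X \<Longrightarrow> vf Y \<Longrightarrow> sm (G X Y)"
  and sm_E [simp]: "vf X \<Longrightarrow> sm (E X)"
  and vf_F [simp]: "vf X \<Longrightarrow> vf (F X)"
  using acm by (auto simp: almost_contact_metric_def riemannian_metric_def one_form_def endomorphism_field_def)

lemma sm_vderiv [simp]: "vf X \<Longrightarrow> sm u \<Longrightarrow> sm (vderiv X u)"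
  by (rule vector_field_smooth)

lemma G_commute: "vf X \<Longrightarrow> vf Y \<Longrightarrow> G X Y = G Y X"
  using acm by (auto simp: almost_contact_metric_def riemannian_metric_def ap2_def vector_field_def fun_eq_iff)

lemma metric_linear_form:
  "vf X \<Longrightarrow> linear_form_on (tangent_space A p) (g p (X p))"
  using acm by (auto simp: almost_contact_metric_def riemannian_metric_def vector_field_def)

lemma G_add_right: "vf X \<Longrightarrow> vf Y \<Longrightarrow> vf Z \<Longrightarrow> G X (Y + Z) = G X Y + G X Z"
  using metric_linear_form[of X] by (auto simp: linear_form_on_def ap2_def vector_field_def fun_eq_iff)

lemma G_scale_right: "vf X \<Longrightarrow> vf Y \<Longrightarrow> G X (f *\<^sub>f Y) = f * G X Y"
  using metric_linear_form[of X] by (auto simp: linear_form_on_def ap2_def vector_field_def fun_eq_iff fscale_def)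

lemma G_minus_right: "vf X \<Longrightarrow> vf Y \<Longrightarrow> G X (- Y) = - G X Y"
  by (simp add: uminus_eq_fscale G_scale_right) (simp add: fun_eq_iff)

lemma G_diff_right: "vf X \<Longrightarrow> vf Y \<Longrightarrow> vf Z \<Longrightarrow> G X (Y - Z) = G X Y - G X Z"
  using G_add_right[of X Y "- Z"] by (simp add: G_minus_right)

lemma G_zero_right: "vf X \<Longrightarrow> G X 0 = 0"
  using G_diff_right[of X X X] by simp

lemma G_left:
  "vf X \<Longrightarrow> vf Y \<Longrightarrow> vf Z \<Longrightarrow> G (X + Y) Z = G X Z + G Y Z"
  "vf X \<Longrightarrow> vf Y \<Longrightarrow> vf Z \<Longrightarrow> G (X - Y) Z = G X Z - G Y Z"
  "vf X \<Longrightarrow> vf Z \<Longrightarrow> G (- X) Z = - G X Z"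
  "sm f \<Longrightarrow> vf X \<Longrightarrow> vf Z \<Longrightarrow> G (f *\<^sub>f X) Z = f * G X Z"
  "vf Z \<Longrightarrow> G 0 Z = 0"
  using G_add_right[of Z X Y] G_diff_right[of Z X Y] G_minus_right[of Z X] G_scale_right[of Z X f]
    G_zero_right[of Z]
  by (simp_all add: G_commute[of _ Z])

lemmas G_simps [simp] = G_left G_add_right G_diff_right G_minus_right G_scale_right G_zero_right

lemma G_pos: "vf X \<Longrightarrow> X p \<noteq> 0 \<Longrightarrow> G X X p > 0"
  using acm by (auto simp: almost_contact_metric_def riemannian_metric_def vector_field_def ap2_def)

text \<open>
Nondegeneracy without extending tangent vectors to fields: the difference of the two fields is itself a
legitimate test field.
\<close>

lemma vf_eqI:
  assumes "vf X" "vf Y" "\<And>Z. vf Z \<Longrightarrow> G X Z = G Y Z"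
  shows "X = Y"
proof -
  have "G (X - Y) (X - Y) p = 0" for p
    using G_left(2)[of X Y "X - Y"] assms(1,2) assms(3)[of "X - Y"] by (simp del: G_simps)
  then have "(X - Y) p = 0" for p
    using G_pos[of "X - Y" p] assms by fastforce
  then show ?thesis by (simp add: fun_eq_iff)
qed

lemma F_linear [simp]:
  "vf X \<Longrightarrow> vf Y \<Longrightarrow> F (X + Y) = F X + F Y"
  "vf X \<Longrightarrow> F (f *\<^sub>f X) = f *\<^sub>f F X"
  using acm by (auto simp: almost_contact_metric_def endomorphism_field_def linear_on_space_def ap1_def
      vector_field_def fun_eq_iff fscale_def)

lemma E_linear [simp]:
  "vf X \<Longrightarrow> vf Y \<Longrightarrow> E (X + Y) = E X + E Y"
  "vf X \<Longrightarrow> E (f *\<^sub>f X) = f * E X"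
  using acm by (auto simp: almost_contact_metric_def one_form_def linear_form_on_def ap1_def
      vector_field_def fun_eq_iff fscale_def)

lemma FE_simps [simp]:
  "vf X \<Longrightarrow> F (- X) = - F X" "vf X \<Longrightarrow> E (- X) = - E X"
  "vf X \<Longrightarrow> vf Y \<Longrightarrow> F (X - Y) = F X - F Y" "vf X \<Longrightarrow> vf Y \<Longrightarrow> E (X - Y) = E X - E Y"
  "F 0 = 0" "E 0 = 0"
proof -
  show m: "F (- X) = - F X" "E (- X) = - E X" if "vf X" for X
    using that unfolding uminus_eq_fscale by (simp_all) (simp add: fun_eq_iff)
  show d: "F (X - Y) = F X - F Y" "E (X - Y) = E X - E Y" if "vf X" "vf Y" for X Y
    using F_linear(1)[of X "- Y"] E_linear(1)[of X "- Y"] that m[of Y] by simp_all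
  show "F 0 = 0" "E 0 = 0"
    using d[of 0 0] by simp_all
qed

lemma E_xi [simp]: "E \<xi> = 1"
  and FF: "vf X \<Longrightarrow> F (F X) = - X + E X *\<^sub>f \<xi>"
  and compatible: "vf X \<Longrightarrow> vf Y \<Longrightarrow> G (F X) (F Y) = G X Y - E X * E Y"
  using acm by (auto simp: almost_contact_metric_def)

text \<open>
Since \<open>\<phi>\<^sup>2 \<xi> = 0\<close>, the formula for \<open>\<phi>\<^sup>2\<close> applied to \<open>\<phi> \<xi>\<close> shows \<open>\<phi> \<xi> = s \<xi>\<close> for a function \<open>s\<close>, and
applying \<open>\<phi>\<close> again gives \<open>s\<^sup>2 = 0\<close>.
\<close>

lemma F_xi [simp]: "F \<xi> = 0"
proof -
  let ?s = "E (F \<xi>)"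
  have 0: "F (F \<xi>) = 0" by (simp add: FF fscale_simps)
  then have "F (F (F \<xi>)) = 0" by simp
  then have 1: "F \<xi> = ?s *\<^sub>f \<xi>" using FF[of "F \<xi>"] by (simp add: eq_neg_iff_add_eq_0)
  have "F (F \<xi>) = ?s *\<^sub>f (?s *\<^sub>f \<xi>)" by (metis 1 F_linear(2) vf_xi)
  then have "E (?s *\<^sub>f (?s *\<^sub>f \<xi>)) = E 0" using 0 by simp
  then have "?s * ?s = 0" by simp
  then have "?s = 0" by (simp add: fun_eq_iff)
  then show ?thesis using 1 by (simp add: fscale_simps)
qed

lemma E_F [simp]: "vf X \<Longrightarrow> E (F X) = 0"
proof -
  assume X: "vf X"
  have "F (F (F X)) = - F X" using X by (subst FF) (simp_all add: fscale_simps)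
  then have "E (E (F X) *\<^sub>f \<xi>) = E 0" using FF[of "F X"] X by simp
  then show ?thesis by (simp add: X)
qed

lemma E_eq: "vf X \<Longrightarrow> E X = G X \<xi>"
  using compatible[of X \<xi>] by simp

lemma G_xi_left [simp]: "vf X \<Longrightarrow> G \<xi> X = E X"
  and G_xi_right [simp]: "vf X \<Longrightarrow> G X \<xi> = E X"
  by (simp_all add: E_eq G_commute)

lemma F_skew: "vf X \<Longrightarrow> vf Y \<Longrightarrow> G (F X) Y = - G X (F Y)"
  using compatible[of "F X" Y] by (simp add: FF)

lemma affine: "affine_connection A N"
  using levi_civita by (simp add: levi_civita_def)

lemma vf_N [simp]: "vf X \<Longrightarrow> vf Y \<Longrightarrow> vf (N X Y)"
  using affine by (simp add: affine_connection_def)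

lemma N_simps:
  "vf X \<Longrightarrow> vf Y \<Longrightarrow> vf Z \<Longrightarrow> N (X + Y) Z = N X Z + N Y Z"
  "vf X \<Longrightarrow> vf Y \<Longrightarrow> vf Z \<Longrightarrow> N X (Y + Z) = N X Y + N X Z"
  "sm f \<Longrightarrow> vf X \<Longrightarrow> vf Y \<Longrightarrow> N (f *\<^sub>f X) Y = f *\<^sub>f N X Y"
  "sm f \<Longrightarrow> vf X \<Longrightarrow> vf Y \<Longrightarrow> N X (f *\<^sub>f Y) = vderiv X f *\<^sub>f Y + f *\<^sub>f N X Y"
  using affine by (simp_all add: affine_connection_def)

lemma N_zero_minus:
  "vf X \<Longrightarrow> N X 0 = 0" "vf X \<Longrightarrow> N 0 X = 0"
  "vf X \<Longrightarrow> vf Y \<Longrightarrow> N X (- Y) = - N X Y" "vf X \<Longrightarrow> vf Y \<Longrightarrow> N (- X) Y = - N X Y"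
  "vf X \<Longrightarrow> vf Y \<Longrightarrow> vf Z \<Longrightarrow> N (X - Y) Z = N X Z - N Y Z"
  "vf X \<Longrightarrow> vf Y \<Longrightarrow> vf Z \<Longrightarrow> N X (Y - Z) = N X Y - N X Z"
proof -
  show z: "N X 0 = 0" "N 0 X = 0" if "vf X" for X
    using that N_simps(2)[of X 0 0] N_simps(1)[of 0 0 X] by simp_all
  show m: "N X (- Y) = - N X Y" "N (- X) Y = - N X Y" if "vf X" "vf Y" for X Y
    using that N_simps(2)[of X Y "- Y"] N_simps(1)[of X "- X" Y] z
    by (simp_all add: eq_neg_iff_add_eq_0 add.commute)
  show "N (X - Y) Z = N X Z - N Y Z" "N X (Y - Z) = N X Y - N X Z" if "vf X" "vf Y" "vf Z" for X Y Z
    using that N_simps(1)[of X "- Y" Z] N_simps(2)[of X Y "- Z"] m by simp_all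
qed

lemmas N_all [simp] = N_simps N_zero_minus

lemma torsion: "vf X \<Longrightarrow> vf Y \<Longrightarrow> lie_bracket A X Y = N X Y - N Y X"
  and metric: "vf X \<Longrightarrow> vf Y \<Longrightarrow> vf Z \<Longrightarrow> vderiv X (G Y Z) = G (N X Y) Z + G Y (N X Z)"
  using levi_civita by (simp_all add: levi_civita_def)

sublocale LC: metric_connection A G vf N
  by unfold_locales (simp_all add: atlas torsion metric G_commute)

lemma scalar_cancel:
  fixes a b :: "'a \<Rightarrow> real"
  shows "a = - a \<Longrightarrow> a = 0" "a + a = b + b \<Longrightarrow> a = b"
  by (auto simp: fun_eq_iff)

section \<open>The covariant derivative of the Reeb field\<close>

text \<open>
It will turn out that \<open>h = \<phi> B\<close>. Restricted to \<open>ker \<eta>\<close>, this is up to sign the shape operator of the leaves.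
\<close>

definition B :: "'a vfield \<Rightarrow> 'a vfield" where "B X = N X \<xi>"

lemma vf_B [simp]: "vf X \<Longrightarrow> vf (B X)"
  by (simp add: B_def)

lemma B_linear [simp]:
  "vf X \<Longrightarrow> vf Y \<Longrightarrow> B (X + Y) = B X + B Y" "vf X \<Longrightarrow> vf Y \<Longrightarrow> B (X - Y) = B X - B Y"
  "vf X \<Longrightarrow> B (- X) = - B X" "sm f \<Longrightarrow> vf X \<Longrightarrow> B (f *\<^sub>f X) = f *\<^sub>f B X" "B 0 = 0"
  by (simp_all add: B_def)

lemma E_B [simp]: "vf X \<Longrightarrow> E (B X) = 0"
proof -
  assume X: "vf X"
  have "vderiv X (G \<xi> \<xi>) = E (B X) + E (B X)"
    using X by (subst metric) (simp_all add: B_def)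
  moreover have "vderiv X (G \<xi> \<xi>) = 0" using X by (simp add: vderiv_1[OF atlas])
  ultimately show ?thesis by (auto simp: fun_eq_iff)
qed

lemma vderiv_E: "vf X \<Longrightarrow> vf Y \<Longrightarrow> vderiv X (E Y) = E (N X Y) + G Y (B X)"
  using metric[of X Y \<xi>] by (simp add: B_def)

lemma B_sym: "vf X \<Longrightarrow> vf Y \<Longrightarrow> G (B X) Y = G X (B Y)"
proof -
  assume XY: "vf X" "vf Y"
  then have "ext_deriv1 A E X Y = 0"
    using almost_cosymplectic by (simp add: almost_cosymplectic_def)
  then have "G Y (B X) = G X (B Y)"
    by (simp add: ext_deriv1_def vderiv_E XY torsion)
  then show ?thesis using G_commute[of Y "B X"] XY by simp
qed

lemma B_xi [simp]: "B \<xi> = 0"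
  by (rule vf_eqI) (simp_all add: B_sym)

section \<open>The covariant derivative of the structure tensor\<close>

text \<open>
The tensor \<open>g ((\<nabla>\<^sub>X \<phi>) Y, Z)\<close>, rewritten with the skew-adjointness of \<open>\<phi>\<close>.
\<close>

definition T :: "'a vfield \<Rightarrow> 'a vfield \<Rightarrow> 'a vfield \<Rightarrow> ('a \<Rightarrow> real)" where
  "T X Y Z = G (N X (F Y)) Z + G (N X Y) (F Z)"

lemma T_skew: "vf X \<Longrightarrow> vf Y \<Longrightarrow> vf Z \<Longrightarrow> T X Z Y = - T X Y Z"
proof -
  assume V: "vf X" "vf Y" "vf Z"
  have "G (F Y) Z + G Y (F Z) = 0" by (simp add: F_skew V)
  moreover have "vderiv X (G (F Y) Z + G Y (F Z)) = T X Y Z + T X Z Y"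
    by (simp add: vderiv_add[of A] V metric T_def G_commute[of "F Y" "N X Z"] G_commute[of Y "N X (F Z)"])
  ultimately have "T X Y Z + T X Z Y = 0"
    using V by (simp add: vderiv_0[OF atlas])
  then show ?thesis by (simp add: eq_neg_iff_add_eq_0 add.commute)
qed

text \<open>
This is \<open>d\<Phi> = 0\<close> with the Lie brackets expressed by the torsion-free connection.
\<close>

lemma T_cyclic: "vf X \<Longrightarrow> vf Y \<Longrightarrow> vf Z \<Longrightarrow> T X Y Z + T Y Z X + T Z X Y = 0"
proof -
  assume V: "vf X" "vf Y" "vf Z"
  have "ext_deriv2 A (fundamental_form \<phi> g) X Y Z = 0"
    using almost_cosymplectic V by (simp add: almost_cosymplectic_def)
  then have "T X Z Y - T Y Z X + T Z Y X = 0"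
    by (simp add: ext_deriv2_def fundamental_form_def V metric torsion T_def
      G_commute[of Y "N X (F Z)"] G_commute[of X "N Y (F Z)"] G_commute[of X "N Z (F Y)"] algebra_simps)
  then show ?thesis
    using T_skew[OF V(1,2,3)] T_skew[OF V(3,1,2)]
    by (simp add: algebra_simps neg_eq_iff_add_eq_0)
qed

text \<open>
Horizontal fields, the sections of \<open>ker \<eta>\<close>; \<open>P\<close> below is the orthogonal projection onto them.
\<close>

definition hor :: "'a vfield \<Rightarrow> bool" where "hor X \<longleftrightarrow> vf X \<and> E X = 0"

lemma hor_simps [simp]:
  "hor X \<Longrightarrow> hor Y \<Longrightarrow> hor (X + Y)" "hor X \<Longrightarrow> hor Y \<Longrightarrow> hor (X - Y)" "hor X \<Longrightarrow> hor (- X)"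
  "sm f \<Longrightarrow> hor X \<Longrightarrow> hor (f *\<^sub>f X)" "vf X \<Longrightarrow> hor (F X)" "vf X \<Longrightarrow> hor (B X)" "hor 0"
  by (simp_all add: hor_def)

definition P :: "'a vfield \<Rightarrow> 'a vfield" where "P X = X - E X *\<^sub>f \<xi>"

lemma hor_P [simp]: "vf X \<Longrightarrow> hor (P X)"
  by (simp add: hor_def P_def)

lemma hor_vf [simp]: "hor X \<Longrightarrow> vf X" and hor_E [simp]: "hor X \<Longrightarrow> E X = 0"
  by (simp_all add: hor_def)

lemma FF_hor [simp]: "hor X \<Longrightarrow> F (F X) = - X"
  by (simp add: FF fscale_simps)

lemma G_P [simp]: "vf X \<Longrightarrow> hor Y \<Longrightarrow> G (P X) Y = G X Y" "vf X \<Longrightarrow> hor Y \<Longrightarrow> G Y (P X) = G Y X"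
  by (simp_all add: P_def)

lemma FB_P [simp]: "vf X \<Longrightarrow> F (P X) = F X" "vf X \<Longrightarrow> B (P X) = B X"
  by (simp_all add: P_def fscale_simps)

lemma hor_eqI:
  assumes "hor X" "hor Y" "\<And>Z. hor Z \<Longrightarrow> G X Z = G Y Z"
  shows "X = Y"
proof (rule vf_eqI)
  show "G X Z = G Y Z" if "vf Z" for Z
    using assms(3)[of "P Z"] assms(1,2) that by simp
qed (use assms in auto)

lemma T_F: "vf X \<Longrightarrow> hor Y \<Longrightarrow> hor Z \<Longrightarrow> T X (F Y) Z = T X Y (F Z)"
  by (simp add: T_def)

lemma T_xi_left: "vf Y \<Longrightarrow> vf Z \<Longrightarrow> T \<xi> Y Z = G (B Y) (F Z) - G (B Z) (F Y)"
proof -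
  assume V: "vf Y" "vf Z"
  have "T Y \<xi> Z = G (B Y) (F Z)" "T Z \<xi> Y = G (B Z) (F Y)"
    using V by (simp_all add: T_def B_def)
  then show ?thesis
    using T_cyclic[of \<xi> Y Z] T_skew[of Y \<xi> Z] V by (simp add: algebra_simps)
qed

text \<open>
By \<open>T_xi_left\<close>, \<open>\<nabla>\<^sub>\<xi> \<phi>\<close> is up to sign \<open>\<phi> B + B \<phi>\<close>. On \<open>ker \<eta>\<close> the former anticommutes with \<open>\<phi>\<close>, as the derivative of
a complex structure, and the latter commutes with \<open>\<phi>\<close>; so both vanish.
\<close>

lemma FB_anticommute_hor:
  assumes "hor Y" shows "B (F Y) = - F (B Y)"
proof (rule hor_eqI)
  have 1: "G (B (F Y)) (F Z) = - G (B Y) Z" if Z: "hor Z" for Z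
  proof -
    have "T \<xi> (F Y) Z = T \<xi> Y (F Z)" using assms Z by (simp add: T_F)
    then have "G (B (F Y)) (F Z) + G (B Z) Y = - G (B Y) Z - G (B (F Z)) (F Y)"
      using assms Z by (simp add: T_xi_left)
    moreover have "G (B Z) Y = G (B Y) Z" "G (B (F Z)) (F Y) = G (B (F Y)) (F Z)"
      using assms Z
      by (simp_all add: B_sym[of Z Y] B_sym[of "F Z" "F Y"] G_commute[of Z] G_commute[of "F Z"])
    ultimately show ?thesis by (simp add: fun_eq_iff) smt
  qed
  show "G (B (F Y)) Z = G (- F (B Y)) Z" if Z: "hor Z" for Z
    using 1[of "F Z"] assms Z by (simp add: F_skew)
qed (use assms in simp_all)

lemma FB_anticommute: "vf Y \<Longrightarrow> B (F Y) = - F (B Y)"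
  using FB_anticommute_hor[of "P Y"] by simp

lemma T_xi_zero: "vf Y \<Longrightarrow> vf Z \<Longrightarrow> T \<xi> Y Z = 0"
  using B_sym[of Z "F Y"]
  by (simp add: T_xi_left FB_anticommute F_skew G_commute[of Z])

lemma h_eq: "vf X \<Longrightarrow> h_tensor A \<phi> \<xi> X = F (B X)"
proof -
  assume X: "vf X"
  have "N \<xi> (F X) = F (N \<xi> X)"
  proof (rule vf_eqI)
    show "G (N \<xi> (F X)) Z = G (F (N \<xi> X)) Z" if Z: "vf Z" for Z
      using T_xi_zero[OF X Z] X Z by (simp add: T_def F_skew eq_neg_iff_add_eq_0)
  qed (use X in simp_all)
  then have "lie_deriv_endo A \<xi> \<phi> X = F (B X) + F (B X)"
    using X by (simp add: lie_deriv_endo_def torsion B_def[symmetric] FB_anticommute)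
  then show ?thesis by (simp add: h_tensor_def fscale_def fun_eq_iff)
qed

lemma curvature_xi:
  assumes "vf X" "vf Y"
  shows "curvature A N X Y \<xi> = \<kappa> *\<^sub>f (E Y *\<^sub>f X - E X *\<^sub>f Y) + \<mu> *\<^sub>f (E Y *\<^sub>f F (B X) - E X *\<^sub>f F (B Y))"
  using kappa_mu assms by (simp add: kappa_mu_space_def h_eq)

section \<open>The covariant derivative of the shape operator\<close>

text \<open>
The tensor \<open>g ((\<nabla>\<^sub>X B) Y, Z)\<close>, rewritten with the self-adjointness of \<open>B\<close>.
\<close>

definition C :: "'a vfield \<Rightarrow> 'a vfield \<Rightarrow> 'a vfield \<Rightarrow> ('a \<Rightarrow> real)" where
  "C X Y Z = G (N X (B Y)) Z - G (N X Y) (B Z)"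

text \<open>
The value of the \<open>(\<kappa>,\<mu>)\<close>-condition on \<open>(X, \<xi>)\<close> reads
\<open>- (\<nabla>\<^sub>\<xi> B) X - B\<^sup>2 X = \<kappa> X + \<mu> \<phi> B X\<close>. Since \<open>\<nabla>\<^sub>\<xi> \<phi> = 0\<close>, the terms with \<open>\<nabla>\<^sub>\<xi> B\<close> and \<open>\<phi> B\<close> anticommute with
\<open>\<phi>\<close> while the other two commute with it, so the equation splits.
\<close>

lemma B_square_form:
  assumes X: "hor X" and Z: "hor Z"
  shows "G (B X) (B Z) = - \<kappa> * G X Z"
proof -
  have e: "- C \<xi> X Z - G (B X) (B Z) = \<kappa> * G X Z + \<mu> * G (F (B X)) Z" if X: "hor X" and Z: "hor Z" for X Z
  proof -
    have "curvature A N X \<xi> \<xi> = \<kappa> *\<^sub>f X + \<mu> *\<^sub>f F (B X)"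
      using X by (simp add: curvature_xi fscale_simps)
    moreover have "curvature A N X \<xi> \<xi> = - N \<xi> (B X) - (B (B X) - B (N \<xi> X))"
      using X by (simp add: curvature_def torsion B_def[symmetric])
    ultimately have "G (- N \<xi> (B X) - (B (B X) - B (N \<xi> X))) Z = G (\<kappa> *\<^sub>f X + \<mu> *\<^sub>f F (B X)) Z"
      by simp
    then show ?thesis using X Z by (simp add: C_def B_sym algebra_simps)
  qed
  have t: "G (N \<xi> (F Y)) W = - G (N \<xi> Y) (F W)" if "vf Y" "vf W" for Y W
    using T_xi_zero[OF that] by (simp add: T_def eq_neg_iff_add_eq_0)
  have "C \<xi> (F X) (F Z) = - C \<xi> X Z"
    using X Z by (simp add: C_def FB_anticommute t)
  moreover have "G (B (F X)) (B (F Z)) = G (B X) (B Z)"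
    using X Z by (simp add: FB_anticommute compatible)
  moreover have "G (F X) (F Z) = G X Z"
    using X Z by (simp add: compatible)
  moreover have "G (F (B (F X))) (F Z) = - G (F (B X)) Z"
    using X Z by (simp add: FB_anticommute F_skew)
  ultimately show ?thesis
    using e[OF X Z] e[of "F X" "F Z"] X Z by (simp add: fun_eq_iff) smt
qed

lemma BB: "hor X \<Longrightarrow> B (B X) = (- \<kappa>) *\<^sub>f X"
  by (rule hor_eqI) (simp_all add: B_square_form B_sym[of "B X" for X])

lemma C_swap_right: "vf X \<Longrightarrow> vf Y \<Longrightarrow> vf Z \<Longrightarrow> C X Z Y = C X Y Z"
proof -
  assume V: "vf X" "vf Y" "vf Z"
  have "vderiv X (G (B Y) Z) = vderiv X (G Y (B Z))" by (simp add: B_sym V)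
  then show ?thesis
    using V by (simp add: metric C_def G_commute[of "B Y" "N X Z"] G_commute[of Y "N X (B Z)"] algebra_simps)
qed

text \<open>
The Codazzi equation: the \<open>(\<kappa>,\<mu>)\<close>-condition makes \<open>R(X,Y)\<xi>\<close> vanish for horizontal \<open>X\<close> and \<open>Y\<close>.
\<close>

lemma C_swap_left: "hor X \<Longrightarrow> hor Y \<Longrightarrow> vf Z \<Longrightarrow> C Y X Z = C X Y Z"
proof -
  assume V: "hor X" "hor Y" "vf Z"
  have "curvature A N X Y \<xi> = 0"
    using V by (simp add: curvature_xi fscale_simps)
  moreover have "curvature A N X Y \<xi> = N X (B Y) - N Y (B X) - B (N X Y - N Y X)"
    using V by (simp add: curvature_def torsion B_def[symmetric])
  ultimately have "G (N X (B Y) - N Y (B X) - B (N X Y - N Y X)) Z = G 0 Z"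
    by simp
  then show ?thesis
    using V by (simp add: C_def B_sym algebra_simps)
qed

text \<open>
The derivative of \<open>B\<^sup>2 = - \<kappa>\<close>.
\<close>

lemma C_B:
  assumes "vf X" "hor Y" "hor Z"
  shows "C X (B Y) Z + C X Y (B Z) = - vderiv X \<kappa> * G Y Z"
  using assms by (simp add: C_def BB vderiv_minus[of A] B_sym[of "N X (B Y)"] algebra_simps)

section \<open>The function \<open>\<kappa>\<close> is constant along the leaves\<close>

text \<open>
With \<open>s = \<plusminus> sqrt (- \<kappa> p)\<close> the field \<open>s X + B X\<close> takes at \<open>p\<close> an eigenvector of \<open>B\<close> as its value. Freezing
\<open>s\<close> at the point makes it a constant coefficient, so the field is globally defined and smooth although it
is an eigenfield at \<open>p\<close> only.
\<close>

lemma B_eigen_at: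
  assumes X: "hor X" and s: "s * s = - \<kappa> p" and V: "vf V"
  shows "G V (B ((\<lambda>_. s) *\<^sub>f X + B X)) p = s * G V ((\<lambda>_. s) *\<^sub>f X + B X) p"
proof -
  have ss: "s * (s * a) = - (\<kappa> p * a)" for a using s by (simp add: mult.assoc[symmetric])
  show ?thesis using X V by (simp add: BB algebra_simps ss)
qed

text \<open>
Let \<open>X'\<close> be the eigenfield at \<open>p\<close> in question. As the eigenspace has dimension at least 2, there is a
second eigenfield \<open>Y\<close> with \<open>Y p\<close> nonzero and orthogonal to \<open>X' p\<close>. By the Codazzi equation \<open>C(X',Y,Y) = C(Y,X',Y)\<close>,
and at \<open>p\<close> the identity \<open>C_B\<close> says that \<open>2 s\<close> times the right-hand side is a multiple of \<open>g(X',Y) = 0\<close>,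
while \<open>2 s\<close> times the left-hand side is \<open>- X'(\<kappa>) g(Y,Y)\<close>.
\<close>

lemma kappa_eigen_derivative:
  assumes X: "hor X" and s: "s * s = - \<kappa> p"
  shows "vderiv ((\<lambda>_. s) *\<^sub>f X + B X) \<kappa> p = 0"
proof -
  define X' where "X' = (\<lambda>_. s) *\<^sub>f X + B X"
  have X': "hor X'" using X by (simp add: X'_def)
  have s0: "s \<noteq> 0" "s * s > 0" using s kappa_neg[of p] by auto
  \<comment> \<open>Three linear conditions at \<open>p\<close>, fewer than the dimension, make \<open>W\<close> horizontal and orthogonal to \<open>X'\<close> and \<open>\<phi> X'\<close>.\<close>
  define I where "I = {\<xi> p, X' p, F X' p}"
  have "\<exists>W. vf W \<and> W p \<noteq> 0 \<and> (\<forall>i\<in>I. g p i (W p) = 0)"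
  proof (rule exists_vector_field_annihilated[OF atlas])
    have "card I \<le> 3" unfolding I_def by (simp add: card_insert_if)
    then show "card I < DIM('e)" using dim by linarith
    show "linear_form_on (tangent_space A p) (g p i)" if "i \<in> I" for i
      using that X' metric_linear_form[of \<xi> p] metric_linear_form[of X' p] metric_linear_form[of "F X'" p]
      by (auto simp: I_def)
  qed (simp add: I_def)
  then obtain W0 where W0: "vf W0" "W0 p \<noteq> 0" "G \<xi> W0 p = 0" "G X' W0 p = 0" "G (F X') W0 p = 0"
    by (auto simp: I_def ap2_def)
  define W where "W = P W0"
  have W: "hor W" using W0 by (simp add: W_def)
  have "W p = W0 p" using W0 by (simp add: W_def P_def fscale_def fun_eq_iff)
  then have WW: "G W W p > 0" using G_pos[of W p] W W0 by simp
  have XW: "G X' W p = 0" "G X' (F W) p = 0"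
    using W0 X' F_skew[of X' W] W by (simp_all add: W_def)
  define Y where "Y U = (\<lambda>_. s) *\<^sub>f U + B U" for U
  have hY: "hor (Y U)" if "hor U" for U using that by (simp add: Y_def)
  \<comment> \<open>The eigenvector part of \<open>W\<close> may vanish; then that of \<open>\<phi> W\<close> does not, since \<open>\<phi>\<close> interchanges the eigenspaces.\<close>
  have "G (Y W) (Y W) p + G (Y (F W)) (Y (F W)) p > 0"
  proof -
    have "G (Y U) (Y U) p = 2 * (s * s) * G U U p + 2 * s * G (B U) U p" if "hor U" for U
    proof -
      have ss: "s * (s * a) = - (\<kappa> p * a)" for a using s by (simp add: mult.assoc[symmetric])
      show ?thesis
        using that by (simp add: Y_def B_square_form G_commute[of U "B U"] algebra_simps ss)
    qed
    moreover have "s * s * G W W p > 0" using WW s0 by simp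
    ultimately show ?thesis
      using W by (simp add: FB_anticommute compatible algebra_simps)
  qed
  then obtain U where U: "hor U" "G X' U p = 0" "G (Y U) (Y U) p \<noteq> 0"
  proof (cases "G (Y W) (Y W) p = 0")
    case True
    with \<open>G (Y W) (Y W) p + G (Y (F W)) (Y (F W)) p > 0\<close> have "G (Y (F W)) (Y (F W)) p \<noteq> 0" by simp
    then show thesis using that[of "F W"] W XW by simp
  qed (use that[of W] W XW in simp)
  let ?Y = "Y U"
  have XY: "G X' ?Y p = 0"
  proof -
    have "G X' (B U) p = G U (B X') p"
      using U X' B_sym[of X' U] G_commute[of U "B X'"] by simp
    also have "\<dots> = s * G X' U p"
      using B_eigen_at[OF X s, of U] G_commute[of U X'] U X' by (simp only: X'_def hor_vf)
    finally show ?thesis using U X' by (simp add: Y_def)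
  qed
  have Y: "hor ?Y" using hY[OF U(1)] .
  have eig_Y: "G V (B ?Y) p = s * G V ?Y p" if "vf V" for V
    unfolding Y_def by (rule B_eigen_at[OF U(1) s that])
  have eig_X: "G V (B X') p = s * G V X' p" if "vf V" for V
    unfolding X'_def by (rule B_eigen_at[OF X s that])
  have eig: "C V V' (B Z') p = s * C V V' Z' p"
    if "hor Z'" "\<And>V. vf V \<Longrightarrow> G V (B Z') p = s * G V Z' p" "vf V" "vf V'" for V V' Z'
  proof -
    have "G (N V V') (B (B Z')) = G (B (N V V')) (B Z')"
      using that B_sym[of "N V V'" "B Z'"] by simp
    then show ?thesis
      using that(2)[of "N V (B V')"] that(2)[of "B (N V V')"] that B_sym[of "N V V'" Z']
      by (simp add: C_def right_diff_distrib)
  qed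
  have "C ?Y (B X') ?Y p + C ?Y X' (B ?Y) p = 0"
    using fun_cong[OF C_B[of ?Y X' ?Y], of p] X' Y XY by simp
  moreover have "C ?Y (B X') ?Y p = s * C ?Y X' ?Y p"
    using eig[OF X' eig_X, of ?Y ?Y] X' Y C_swap_right[of ?Y "B X'" ?Y] C_swap_right[of ?Y X' ?Y] by simp
  moreover have "C ?Y X' (B ?Y) p = s * C ?Y X' ?Y p"
    using eig[OF Y eig_Y, of ?Y X'] X' Y by simp
  ultimately have "C ?Y X' ?Y p = 0" using s0 by simp
  then have c: "C X' ?Y ?Y p = 0" using C_swap_left[of X' ?Y ?Y] X' Y by simp
  have "C X' (B ?Y) ?Y p + C X' ?Y (B ?Y) p = - vderiv X' \<kappa> p * G ?Y ?Y p"
    using fun_cong[OF C_B[of X' ?Y ?Y], of p] X' Y by simp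
  moreover have "C X' (B ?Y) ?Y = C X' ?Y (B ?Y)"
    using X' Y C_swap_right[of X' ?Y "B ?Y"] by simp
  moreover have "C X' ?Y (B ?Y) p = 0"
    using eig[OF Y eig_Y, of X' ?Y] X' Y c by simp
  ultimately have "vderiv X' \<kappa> p = 0" using U(3) by simp
  then show ?thesis by (simp add: X'_def)
qed

lemma kappa_constant_hor: "hor X \<Longrightarrow> vderiv X \<kappa> = 0"
proof
  fix p assume X: "hor X"
  define s where "s = sqrt (- \<kappa> p)"
  have s: "s * s = - \<kappa> p" "(- s) * (- s) = - \<kappa> p" "s \<noteq> 0"
    using kappa_neg[of p] by (auto simp: s_def)
  show "vderiv X \<kappa> p = 0 p"
    using kappa_eigen_derivative[OF X s(1)] kappa_eigen_derivative[OF X s(2)] s(3) by simp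
qed

section \<open>Both structure tensors are parallel along the leaves\<close>

lemma kappa_cancel: "\<kappa> * a = 0 \<Longrightarrow> a = 0"
  using kappa_neg by (auto simp: fun_eq_iff) (metis less_irrefl)

text \<open>
With \<open>\<kappa>\<close> constant along the leaves, \<open>C(X,BY,Z) = - C(X,Y,BZ)\<close>. Moving \<open>B\<close> once around the three slots of
the totally symmetric \<open>C\<close> changes the sign three times, so \<open>C(X,Y,BZ) = 0\<close>; and \<open>B\<close> is invertible on \<open>ker \<eta>\<close>.
\<close>

lemma C_zero:
  assumes "hor X" "hor Y" "hor Z"
  shows "C X Y Z = 0"
proof -
  have anti: "C X (B Y) Z = - C X Y (B Z)" if "hor X" "hor Y" "hor Z" for X Y Z
    using C_B[of X Y Z] that by (simp add: kappa_constant_hor eq_neg_iff_add_eq_0)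
  have 0: "C X Y (B Z) = 0" if V: "hor X" "hor Y" "hor Z" for X Y Z
  proof (rule scalar_cancel(1))
    have "C X Y (B Z) = - C X (B Y) Z" using anti V by simp
    also have "\<dots> = - C X Z (B Y)" using V by (simp add: C_swap_right[of X "B Y" Z])
    also have "\<dots> = - C Z X (B Y)" using V by (simp add: C_swap_left[of Z X])
    also have "\<dots> = C Z (B X) Y" using V by (simp add: anti)
    also have "\<dots> = C Z Y (B X)" using V by (simp add: C_swap_right[of Z "B X" Y])
    also have "\<dots> = C Y Z (B X)" using V by (simp add: C_swap_left[of Y Z])
    also have "\<dots> = - C Y (B Z) X" using V by (simp add: anti)
    also have "\<dots> = - C Y X (B Z)" using V by (simp add: C_swap_right[of Y "B Z" X])
    also have "\<dots> = - C X Y (B Z)" using V by (simp add: C_swap_left[of X Y])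
    finally show "C X Y (B Z) = - C X Y (B Z)" .
  qed
  have "\<kappa> * C X Y Z = - C X Y (B (B Z))"
    using assms by (simp add: C_def BB algebra_simps)
  also have "\<dots> = 0" using 0[of X Y "B Z"] assms by simp
  finally show ?thesis by (rule kappa_cancel)
qed

lemma N_B: "hor X \<Longrightarrow> hor Y \<Longrightarrow> hor Z \<Longrightarrow> G (N X (B Y)) Z = G (N X Y) (B Z)"
  using C_zero[of X Y Z] by (simp add: C_def)

text \<open>
As \<open>B\<close> is parallel and anticommutes with \<open>\<phi>\<close>, it also anticommutes with the derivative of \<open>\<phi>\<close>, which is the fact
\<open>TB\<close>. The tensor \<open>Q\<close> isolates the components of \<open>T\<close> whose first two arguments lie in the same
eigenspace of \<open>B\<close>: it is symmetric in these arguments by the cyclic identity, whereas \<open>Q(X,Y,\<phi>W)\<close> is skew in \<open>Y\<close>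
and \<open>W\<close>. A trilinear form that is symmetric in one pair of slots and skew in an overlapping pair is zero.
What remains of \<open>T\<close> is killed by its skewness in the last two slots.
\<close>

lemma T_zero:
  assumes "hor X" "hor Y" "hor Z"
  shows "T X Y Z = 0"
proof -
  have TB: "T X (B Y) Z = - T X Y (B Z)" if "hor X" "hor Y" "hor Z" for X Y Z
  proof -
    have "- G (N X (F (B Y))) Z = G (N X (F Y)) (B Z)"
      using that N_B[of X "F Y" Z] by (simp add: FB_anticommute)
    then have "G (N X (F (B Y))) Z = - G (N X (F Y)) (B Z)" by (metis minus_minus)
    moreover have "G (N X (B Y)) (F Z) = - G (N X Y) (F (B Z))"
      using that N_B[of X Y "F Z"] by (simp add: FB_anticommute)
    ultimately show ?thesis by (simp add: T_def)
  qed
  have sk: "T X Z Y = - T X Y Z" if "hor X" "hor Y" "hor Z" for X Y Z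
    using that by (intro T_skew) simp_all
  define Q where "Q X Y Z = T (B X) Y Z + T X (B Y) Z" for X Y Z
  have Q_sym: "Q Y X Z = Q X Y Z" if V: "hor X" "hor Y" "hor Z" for X Y Z
  proof -
    have "T (B X) Y Z + T Y Z (B X) + T Z (B X) Y = 0" "T X (B Y) Z + T (B Y) Z X + T Z X (B Y) = 0"
      using V by (simp_all add: T_cyclic)
    moreover have "T Z (B X) Y = - T Z X (B Y)" "T Y Z (B X) = - T Y (B X) Z" "T (B Y) Z X = - T (B Y) X Z"
      using V sk[of Y "B X" Z] sk[of "B Y" X Z] TB[of Z X Y] by simp_all
    ultimately show ?thesis by (simp add: Q_def algebra_simps)
  qed
  have Q_skew: "Q X W (F Y) = - Q X Y (F W)" if V: "hor X" "hor Y" "hor W" for X Y W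
  proof -
    have "T (B X) W (F Y) = - T (B X) Y (F W)"
      using V sk[of "B X" "F Y" W] by (simp add: T_F[symmetric])
    moreover have "T X (B W) (F Y) = - T X (B Y) (F W)"
    proof -
      have "T X (B Y) (F W) = T X (F Y) (B W)"
      proof -
        have "T X (B Y) (F W) = T X (F (B Y)) W" using V by (simp add: T_F)
        also have "\<dots> = - T X (B (F Y)) W" using V by (simp add: T_def FB_anticommute)
        also have "\<dots> = T X (F Y) (B W)" using V by (simp add: TB)
        finally show ?thesis .
      qed
      then show ?thesis using V sk[of X "F Y" "B W"] by simp
    qed
    ultimately show ?thesis by (simp add: Q_def)
  qed
  have Q_F: "Q X Y (F W) = 0" if V: "hor X" "hor Y" "hor W" for X Y W
  proof (rule scalar_cancel(1))
    have "Q X Y (F W) = - Q X W (F Y)" using V by (simp add: Q_skew[of X W Y])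
    also have "\<dots> = - Q W X (F Y)" using V by (simp add: Q_sym[of W X])
    also have "\<dots> = Q W Y (F X)" using V by (simp add: Q_skew[of W Y X])
    also have "\<dots> = Q Y W (F X)" using V by (simp add: Q_sym[of Y W])
    also have "\<dots> = - Q Y X (F W)" using V by (simp add: Q_skew[of Y X W])
    also have "\<dots> = - Q X Y (F W)" using V by (simp add: Q_sym[of X Y])
    finally show "Q X Y (F W) = - Q X Y (F W)" .
  qed
  have Q0: "T (B X) Y Z = - T X (B Y) Z" if V: "hor X" "hor Y" "hor Z" for X Y Z
  proof -
    have "Q X Y Z = - Q X Y (F (F Z))"
      using V by (simp add: Q_def T_def)
    also have "\<dots> = 0" using V by (simp add: Q_F del: FF_hor)
    finally show ?thesis by (simp add: Q_def eq_neg_iff_add_eq_0)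
  qed
  have 0: "T X Y (B Z) = 0" if V: "hor X" "hor Y" "hor Z" for X Y Z
  proof (rule scalar_cancel(1))
    have "T X Y (B Z) = T (B X) Y Z" using V by (simp add: Q0 TB)
    also have "\<dots> = - T (B X) Z Y" using V by (simp add: sk[of "B X" Z Y])
    also have "\<dots> = T X (B Z) Y" using V by (simp add: Q0)
    also have "\<dots> = - T X Y (B Z)" using V by (simp add: sk[of X Y "B Z"])
    finally show "T X Y (B Z) = - T X Y (B Z)" .
  qed
  have "\<kappa> * T X Y Z = - T X Y (B (B Z))"
    using assms by (simp add: T_def BB algebra_simps)
  also have "\<dots> = 0" using 0[of X Y "B Z"] assms by simp
  finally show ?thesis by (rule kappa_cancel)
qed

lemma N_F: "hor X \<Longrightarrow> hor Y \<Longrightarrow> hor Z \<Longrightarrow> G (N X (F Y)) Z = - G (N X Y) (F Z)"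
  using T_zero[of X Y Z] by (simp add: T_def eq_neg_iff_add_eq_0)

section \<open>Flatness of the leaves\<close>

text \<open>
The Levi-Civita connection of the leaves.
\<close>

definition leaf_nabla :: "'a vfield \<Rightarrow> 'a vfield \<Rightarrow> 'a vfield" where "leaf_nabla X Y = P (N X Y)"

lemma P_linear [simp]:
  "vf X \<Longrightarrow> vf Y \<Longrightarrow> P (X + Y) = P X + P Y" "vf X \<Longrightarrow> vf Y \<Longrightarrow> P (X - Y) = P X - P Y"
  "vf X \<Longrightarrow> P (f *\<^sub>f X) = f *\<^sub>f P X"
  by (simp_all add: P_def fscale_simps)

lemma hor_leaf_nabla [simp]: "vf X \<Longrightarrow> vf Y \<Longrightarrow> hor (leaf_nabla X Y)"
  by (simp add: leaf_nabla_def)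

lemma E_N: "vf X \<Longrightarrow> hor Y \<Longrightarrow> E (N X Y) = - G (B X) Y"
  using vderiv_E[of X Y] by (simp add: vderiv_0[OF atlas] G_commute[of Y] eq_neg_iff_add_eq_0)

lemma hor_lie_bracket: "hor X \<Longrightarrow> hor Y \<Longrightarrow> lie_bracket A X Y = leaf_nabla X Y - leaf_nabla Y X"
  by (simp add: torsion leaf_nabla_def P_def E_N B_sym[of Y X] G_commute[of Y])

sublocale leaf: metric_connection A G hor leaf_nabla
proof
  show "lie_bracket A X Y = leaf_nabla X Y - leaf_nabla Y X" if "hor X" "hor Y" for X Y
    using that by (rule hor_lie_bracket)
qed (simp_all add: atlas metric G_commute leaf_nabla_def)

lemma leaf_nabla_B: "hor X \<Longrightarrow> hor Y \<Longrightarrow> leaf_nabla X (B Y) = B (leaf_nabla X Y)"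
  by (rule hor_eqI) (simp_all add: leaf_nabla_def N_B B_sym)

lemma leaf_nabla_F: "hor X \<Longrightarrow> hor Y \<Longrightarrow> leaf_nabla X (F Y) = F (leaf_nabla X Y)"
  by (rule hor_eqI) (simp_all add: leaf_nabla_def N_F F_skew)

lemma leaf_nabla_minus [simp]: "hor X \<Longrightarrow> hor Y \<Longrightarrow> leaf_nabla X (- Y) = - leaf_nabla X Y"
  by (simp add: leaf_nabla_def P_def fscale_simps)

text \<open>
The leaf curvature commutes with \<open>B\<close>, since \<open>B\<close> is parallel, so by pair symmetry \<open>R(BX,Y) = R(X,BY)\<close>. The
tensor \<open>Q\<close> measures the failure of \<open>R(X,Y)BZ = R(BX,Y)Z\<close>; the Bianchi identity makes it cyclic in \<open>X, Y, Z\<close>,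
and this contradicts the signs with which \<open>B\<close> moves through its slots unless \<open>Q = 0\<close>. Then
\<open>R(BX,Y)BZ = - \<kappa> R(X,Y)Z\<close>; conjugating this identity with \<open>\<phi>\<close>, which preserves \<open>R\<close> and changes the sign of \<open>B\<close>,
shows that both sides equal their negatives.
\<close>

lemma leaf_flat:
  assumes "hor X" "hor Y" "hor Z" "hor W"
  shows "leaf.K X Y Z W = 0"
proof -
  let ?R = leaf.K
  have B3: "?R X Y (B Z) W = ?R X Y Z (B W)" if "hor X" "hor Y" "hor Z" "hor W" for X Y Z W
    using that leaf.V_curvature[of X Y Z]
    by (simp add: leaf.K_def leaf.curvature_expand leaf_nabla_B B_sym)
  have F3: "?R X Y (F Z) W = - ?R X Y Z (F W)" if "hor X" "hor Y" "hor Z" "hor W" for X Y Z W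
    using that leaf.V_curvature[of X Y Z]
    by (simp add: leaf.K_def leaf.curvature_expand leaf_nabla_F F_skew)
  have B1: "?R (B X) Y Z W = ?R X (B Y) Z W" if "hor X" "hor Y" "hor Z" "hor W" for X Y Z W
    using that B3[of Z W X Y] by (simp add: leaf.K_pair_symmetry[of _ _ Z W])
  define Q where "Q X Y Z W = ?R X Y (B Z) W - ?R (B X) Y Z W" for X Y Z W
  have Q_cyc: "Q X Y Z W = Q Y Z X W" if V: "hor X" "hor Y" "hor Z" "hor W" for X Y Z W
  proof -
    have "?R X Y (B Z) W + ?R Y (B Z) X W + ?R (B Z) X Y W = 0"
      "?R (B X) Y Z W + ?R Y Z (B X) W + ?R Z (B X) Y W = 0"
      using V by (simp_all add: leaf.K_bianchi)
    moreover have "?R (B Z) X Y W = ?R Z (B X) Y W" "?R Y (B Z) X W = ?R (B Y) Z X W"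
      using V by (simp_all add: B1)
    ultimately have "?R X Y (B Z) W + ?R (B Y) Z X W = ?R (B X) Y Z W + ?R Y Z (B X) W"
      by (metis add_right_cancel)
    then show ?thesis by (simp add: Q_def algebra_simps)
  qed
  have Q_B: "Q (B X) Y Z W = Q X (B Y) Z W" if "hor X" "hor Y" "hor Z" "hor W" for X Y Z W
    using that by (simp add: Q_def B1)
  have BB4: "?R X Y Z (B (B W)) = - \<kappa> * ?R X Y Z W" if "hor X" "hor Y" "hor Z" "hor W" for X Y Z W
    using that leaf.V_curvature[of X Y Z] by (simp add: leaf.K_def BB)
  have BB3: "?R X Y (B (B Z)) W = - \<kappa> * ?R X Y Z W" if "hor X" "hor Y" "hor Z" "hor W" for X Y Z W
    using that BB4[of X Y Z W] by (simp add: B3)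
  have BB1: "?R (B (B X)) Y Z W = - \<kappa> * ?R X Y Z W" if "hor X" "hor Y" "hor Z" "hor W" for X Y Z W
    using that BB3[of Z W X Y] by (simp add: leaf.K_pair_symmetry[of _ _ Z W])
  have Q_B_right: "Q X Y (B Z) W = - Q (B X) Y Z W" if "hor X" "hor Y" "hor Z" "hor W" for X Y Z W
    using that by (simp add: Q_def BB1 BB3)
  have Q0: "Q (B X) Y Z W = 0" if V: "hor X" "hor Y" "hor Z" "hor W" for X Y Z W
  proof (rule scalar_cancel(1))
    have "Q (B X) Y Z W = Q Y Z (B X) W" using V by (simp add: Q_cyc[of "B X"])
    also have "\<dots> = - Q (B Y) Z X W" using V by (simp add: Q_B_right)
    also have "\<dots> = - Q X (B Y) Z W" using V by (simp add: Q_cyc[of X "B Y"])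
    also have "\<dots> = - Q (B X) Y Z W" using V by (simp add: Q_B)
    finally show "Q (B X) Y Z W = - Q (B X) Y Z W" .
  qed
  have e: "?R (B X) Y (B Z) W = - \<kappa> * ?R X Y Z W" if "hor X" "hor Y" "hor Z" "hor W" for X Y Z W
    using that Q0[of X Y Z W] by (simp add: Q_def BB1 eq_neg_iff_add_eq_0)
  have FF34: "?R X Y (F Z) (F W) = ?R X Y Z W" if "hor X" "hor Y" "hor Z" "hor W" for X Y Z W
    using F3[of X Y Z "F W"] that leaf.V_curvature[of X Y Z] by (simp add: leaf.K_def)
  have "- \<kappa> * ?R X Y Z W = - \<kappa> * ?R X Y (F Z) (F W)"
    using assms by (simp add: FF34)
  also have "\<dots> = ?R (B X) Y (B (F Z)) (F W)" using assms by (simp add: e)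
  also have "\<dots> = - ?R (B X) Y (F (B Z)) (F W)"
  proof -
    have "curvature A leaf_nabla (B X) Y (- V) = - curvature A leaf_nabla (B X) Y V" if "hor V" for V
      using that assms by (simp add: leaf.curvature_expand)
    then show ?thesis
      using assms leaf.V_curvature[of "B X" Y "F (B Z)"] by (simp add: FB_anticommute leaf.K_def)
  qed
  also have "\<dots> = - ?R (B X) Y (B Z) W"
    using assms by (simp add: FF34)
  also have "\<dots> = \<kappa> * ?R X Y Z W" using assms by (simp add: e)
  finally have "\<kappa> * ?R X Y Z W = - (\<kappa> * ?R X Y Z W)" by simp
  then show ?thesis by (rule kappa_cancel[OF scalar_cancel(1)])
qed

section \<open>The curvature tensor\<close>

text \<open>
The Gauss equation for the flat leaves.
\<close>

lemma curvature_hor: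
  assumes V: "hor X" "hor Y" "hor Z" "hor W"
  shows "LC.K X Y Z W = G (B X) Z * G (B Y) W - G (B Y) Z * G (B X) W"
proof -
  have dec: "N X Y = leaf_nabla X Y - G (B X) Y *\<^sub>f \<xi>" if "vf X" "hor Y" for X Y
    using that by (simp add: leaf_nabla_def P_def E_N fscale_simps)
  have one: "G (N U U') W = G (leaf_nabla U U') W" if "vf U" "vf U'" for U U'
    using that V by (simp add: leaf_nabla_def)
  have two: "G (N X (N Y Z)) W = G (leaf_nabla X (leaf_nabla Y Z)) W - G (B Y) Z * G (B X) W"
    if "hor X" "hor Y" "hor Z" for X Y Z
    using that V(4) one[of X "leaf_nabla Y Z"] by (simp add: dec[of Y Z] B_def[symmetric])
  have hor_bracket: "hor (lie_bracket A X Y)"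
    using V by (simp add: hor_lie_bracket)
  have "LC.K X Y Z W = G (N X (N Y Z)) W - G (N Y (N X Z)) W - G (N (lie_bracket A X Y) Z) W"
    using V by (simp add: LC.K_def curvature_def torsion)
  also have "\<dots> = leaf.K X Y Z W - G (B Y) Z * G (B X) W + G (B X) Z * G (B Y) W"
    using V hor_bracket
    by (simp add: leaf.K_def curvature_def two one[of "lie_bracket A X Y" Z] algebra_simps del: N_all)
  finally show ?thesis using V by (simp add: leaf_flat)
qed

text \<open>
The value of \<open>g(R(X,Y)\<xi>, Z)\<close> prescribed by the \<open>(\<kappa>,\<mu>)\<close>-condition.
\<close>

definition reeb_curvature :: "'a vfield \<Rightarrow> 'a vfield \<Rightarrow> 'a vfield \<Rightarrow> ('a \<Rightarrow> real)" where
  "reeb_curvature X Y Z = \<kappa> * (E Y * G X Z - E X * G Y Z) + \<mu> * (E Y * G (F (B X)) Z - E X * G (F (B Y)) Z)"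

lemma vf_curvature [simp]: "vf X \<Longrightarrow> vf Y \<Longrightarrow> vf Z \<Longrightarrow> vf (curvature A N X Y Z)"
  by (rule LC.V_curvature)

lemma K_reeb: "vf X \<Longrightarrow> vf Y \<Longrightarrow> vf Z \<Longrightarrow> LC.K X Y \<xi> Z = reeb_curvature X Y Z"
  by (simp add: LC.K_def curvature_xi reeb_curvature_def algebra_simps)

lemma K_split:
  assumes V: "vf X" "vf Y" "vf Z" "vf W"
  shows "LC.K X Y Z W = LC.K X Y (P Z) (P W) + E Z * reeb_curvature X Y (P W) - E W * reeb_curvature X Y (P Z)"
proof -
  have right: "LC.K X Y Z W = LC.K X Y Z (P W) + E W * LC.K X Y Z \<xi>"
    if "vf Z" "vf W" for Z W
    using that V(1,2) by (simp add: LC.K_def P_def algebra_simps)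
  have xi: "LC.K X Y U \<xi> = - reeb_curvature X Y U" if "vf U" for U
    using LC.K_skew_right[of X Y \<xi> U] V that by (simp add: K_reeb)
  have "reeb_curvature X Y (P W) = reeb_curvature X Y W"
    using V by (simp add: reeb_curvature_def P_def algebra_simps)
  moreover have "LC.K X Y Z W = - LC.K X Y W Z"
    by (rule LC.K_skew_right[OF V(1,2,4,3)])
  moreover have "LC.K X Y W Z = LC.K X Y W (P Z) - E Z * reeb_curvature X Y W"
    using right[OF V(4,3)] xi[OF V(4)] by simp
  moreover have "LC.K X Y W (P Z) = - LC.K X Y (P Z) W"
    using LC.K_skew_right[of X Y "P Z" W] V by simp
  moreover have "LC.K X Y (P Z) W = LC.K X Y (P Z) (P W) - E W * reeb_curvature X Y (P Z)"
    using right[of "P Z" W] xi[of "P Z"] V by simp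
  ultimately show ?thesis by simp
qed

text \<open>
Splitting off the \<open>\<xi>\<close>-components of the last pair, exchanging the pairs and splitting again leaves only the Gauss term,
because \<open>R(X,Y)\<xi>\<close> vanishes on horizontal \<open>X\<close> and \<open>Y\<close>.
\<close>

lemma K_formula:
  assumes V: "vf X" "vf Y" "vf Z" "vf W"
  shows "LC.K X Y Z W = G (B X) Z * G (B Y) W - G (B Y) Z * G (B X) W
    + E Z * reeb_curvature X Y (P W) - E W * reeb_curvature X Y (P Z)"
proof -
  have "LC.K X Y (P Z) (P W) = LC.K (P Z) (P W) X Y"
    using V by (simp add: LC.K_pair_symmetry[of X])
  also have "\<dots> = LC.K (P Z) (P W) (P X) (P Y)"
    using V K_split[of "P Z" "P W" X Y] by (simp add: reeb_curvature_def)
  also have "\<dots> = G (B Z) X * G (B W) Y - G (B W) X * G (B Z) Y"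
    using V by (simp add: curvature_hor B_sym)
  also have "\<dots> = G (B X) Z * G (B Y) W - G (B Y) Z * G (B X) W"
    using V by (simp add: B_sym[of X] B_sym[of Y] G_commute[of X] G_commute[of Y] mult.commute)
  finally show ?thesis using K_split[OF V] by simp
qed

lemma curvature_formula:
  assumes V: "vf X" "vf Y" "vf Z"
  shows "curvature A nabla X Y Z =
      (- \<kappa>) *\<^sub>f R3 G \<xi> E X Y Z - R5_2 G F (h_tensor A \<phi> \<xi>) X Y Z - \<mu> *\<^sub>f R6 G \<xi> E (h_tensor A \<phi> \<xi>) X Y Z"
proof (rule vf_eqI)
  fix W assume W: "vf W"
  have "G (curvature A N X Y Z) W = LC.K X Y Z W" by (simp add: LC.K_def)
  also have "\<dots> = G ((- \<kappa>) *\<^sub>f R3 G \<xi> E X Y Z - R5_2 G F (h_tensor A \<phi> \<xi>) X Y Z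
      - \<mu> *\<^sub>f R6 G \<xi> E (h_tensor A \<phi> \<xi>) X Y Z) W"
    using V W by (simp add: K_formula[OF V W] reeb_curvature_def R3_def R5_2_def R6_def h_eq P_def algebra_simps)
  finally show "G (curvature A N X Y Z) W = G ((- \<kappa>) *\<^sub>f R3 G \<xi> E X Y Z - R5_2 G F (h_tensor A \<phi> \<xi>) X Y Z
      - \<mu> *\<^sub>f R6 G \<xi> E (h_tensor A \<phi> \<xi>) X Y Z) W" .
qed (use V in \<open>simp_all add: R3_def R5_2_def R6_def h_eq\<close>)

end

theorem theorem3p7:
  fixes A :: "('a::{t2_space,second_countable_topology}, 'e::euclidean_space) atlas"
    and \<phi> :: "'a endo" and \<xi> :: "'a vfield" and \<eta> :: "'a oneform" and g :: "'a bilin"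
    and nabla :: "'a connection"
    and \<kappa> \<mu> :: "'a \<Rightarrow> real"
  assumes "almost_cosymplectic A \<phi> \<xi> \<eta> g"
    and "levi_civita A g nabla"
    and "kappa_mu_space A \<phi> \<xi> \<eta> g nabla \<kappa> \<mu>"
    and "DIM('e) \<ge> 5"
    and "\<forall>p. \<kappa> p < 0"
  shows "(\<forall>X Y Z. vector_field A X \<longrightarrow> vector_field A Y \<longrightarrow> vector_field A Z \<longrightarrow>
            curvature A nabla X Y Z =
              (- \<kappa>) *\<^sub>f R3 (ap2 g) \<xi> (ap1 \<eta>) X Y Z
              - R5_2 (ap2 g) (ap1 \<phi>) (h_tensor A \<phi> \<xi>) X Y Z
              - \<mu> *\<^sub>f R6 (ap2 g) \<xi> (ap1 \<eta>) (h_tensor A \<phi> \<xi>) X Y Z)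
       \<and> gen_space_form_divided_R5 A \<phi> \<xi> \<eta> g nabla 0 0 (- \<kappa>) 0 0 (- 1) (- \<mu>)"
proof -
  interpret almost_cosymplectic_kappa_mu A \<phi> \<xi> \<eta> g nabla \<kappa> \<mu>
    by unfold_locales (use assms in auto)
  have "gen_space_form_divided_R5 A \<phi> \<xi> \<eta> g nabla 0 0 (- \<kappa>) 0 0 (- 1) (- \<mu>)"
    unfolding gen_space_form_divided_R5_def
    using acm levi_civita by (simp add: curvature_formula fscale_simps)
  then show ?thesis using curvature_formula by blast
qed

end
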